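(* Let $V\in L^\infty_{loc}(Q_T)$ be nonnegative and let $u$ be a weak solution of $$\partial_tu-\Delta u+V(x,t)u=0\ \text{ in } Q_T,\qquad u(\cdot,0)=0\ \text{ in }\mathbb{R}^n .$$ If there is some $\lambda>0$ such that $$\iint_{Q_T}(1+V(x,t))\,e^{-\lambda|x|^2}|u(x,t)|\,dx\,dt<\infty,$$ then $u=0$.
   Context: Here $n\ge 1$, $T>0$, $Q_T=\mathbb{R}^n\times(0,T)$, $\overline{Q}_T=\mathbb{R}^n\times[0,T]$. $L^1_{loc}(\overline Q_T)$ is the set of measurable functions integrable on compact subsets of $\overline Q_T$. For a Radon measure $\mu$ in $\mathbb{R}^n$, a weak solution of $\partial_tu-\Delta u+Vu=0$ in $Q_T$, $u(\cdot,0)=\mu$, is a function $u\in L^1_{loc}(\overline Q_T)$ with $Vu\in L^1_{loc}(\overline Q_T)$ such that $$-\iint_{Q_T}u(\partial_t\phi+\Delta\phi)\,dx\,dt+\iint_{Q_T}Vu\phi\,dx\,dt=\int_{\mathbb{R}^n}\phi(x,0)\,d\mu(x)$$ for every $\phi\in X(Q_T)$, where $X(Q_T)$ is the set of $\phi\in C_c(\overline Q_T)$ with $\partial_t\phi+\Delta\phi\in L^\infty_{loc}(\overline Q_T)$ and $\phi(\cdot,T)=0$. *)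

theory Defs
  imports "HOL-Analysis.Analysis"
begin

definition Q :: "real \<Rightarrow> ((real^'n) \<times> real) set" where
  "Q T = UNIV \<times> {0<..<T}"

definition Qbar :: "real \<Rightarrow> ((real^'n) \<times> real) set" where
  "Qbar T = UNIV \<times> {0..T}"

text \<open>
  Functions on a set \<open>S\<close> are represented by total functions whose values outside \<open>S\<close> are
  irrelevant; classes modulo null sets are represented by arbitrary representatives, so
  pointwise relations between such functions are stated almost everywhere.
\<close>

definition L1_loc :: "'a::euclidean_space set \<Rightarrow> ('a \<Rightarrow> real) set" where
  "L1_loc S = {f. set_borel_measurable lebesgue S f \<and>
     (\<forall>K. compact K \<and> K \<subseteq> S \<longrightarrow> set_integrable lebesgue K f)}"

definition Linf_loc :: "'a::euclidean_space set \<Rightarrow> ('a \<Rightarrow> real) set" where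
  "Linf_loc S = {f. set_borel_measurable lebesgue S f \<and>
     (\<forall>K. compact K \<and> K \<subseteq> S \<longrightarrow> (\<exists>C. AE z in lebesgue. z \<in> K \<longrightarrow> \<bar>f z\<bar> \<le> C))}"

definition dderiv :: "'a::euclidean_space \<Rightarrow> ('a \<Rightarrow> real) \<Rightarrow> 'a \<Rightarrow> real" where
  "dderiv v f z = frechet_derivative f (at z) v"

primrec Ck :: "nat \<Rightarrow> ('a::euclidean_space \<Rightarrow> real) \<Rightarrow> bool" where
  "Ck 0 f \<longleftrightarrow> continuous_on UNIV f"
| "Ck (Suc k) f \<longleftrightarrow> (\<forall>z. f differentiable (at z)) \<and> (\<forall>v. Ck k (dderiv v f))"

definition test_functions :: "'a::euclidean_space set \<Rightarrow> ('a \<Rightarrow> real) set" where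
  "test_functions S = {\<psi>. (\<forall>k. Ck k \<psi>) \<and> (\<exists>K. compact K \<and> K \<subseteq> S \<and> (\<forall>z. z \<notin> K \<longrightarrow> \<psi> z = 0))}"

definition time_deriv :: "((real^'n) \<times> real \<Rightarrow> real) \<Rightarrow> (real^'n) \<times> real \<Rightarrow> real" where
  "time_deriv f = dderiv (0, 1) f"

definition space_laplacian :: "((real^'n) \<times> real \<Rightarrow> real) \<Rightarrow> (real^'n) \<times> real \<Rightarrow> real" where
  "space_laplacian f z = (\<Sum>i\<in>UNIV. dderiv (axis i 1, 0) (dderiv (axis i 1, 0) f) z)"

text \<open>
  \<open>backward_heat T \<phi> g\<close>: the function \<open>g\<close> represents the distribution
  \<open>\<partial>\<^sub>t \<phi> + \<Delta> \<phi>\<close> on \<open>Q T\<close> and is locally bounded up to the boundary. Such a \<open>g\<close> is unique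
  up to a null set. The sign of \<open>time_deriv\<close> comes from integrating by parts once.
\<close>

definition backward_heat ::
  "real \<Rightarrow> ((real^'n) \<times> real \<Rightarrow> real) \<Rightarrow> ((real^'n) \<times> real \<Rightarrow> real) \<Rightarrow> bool" where
  "backward_heat T \<phi> g \<longleftrightarrow> g \<in> Linf_loc (Qbar T) \<and>
     (\<forall>\<psi>\<in>test_functions (Q T).
        (LINT z:Q T|lebesgue. \<phi> z * (- time_deriv \<psi> z + space_laplacian \<psi> z))
        = (LINT z:Q T|lebesgue. g z * \<psi> z))"

definition X :: "real \<Rightarrow> ((real^'n) \<times> real \<Rightarrow> real) set" where
  "X T = {\<phi>. continuous_on (Qbar T) \<phi> \<and>
     (\<exists>K. compact K \<and> K \<subseteq> Qbar T \<and> (\<forall>z\<in>Qbar T - K. \<phi> z = 0)) \<and>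
     (\<exists>g. backward_heat T \<phi> g) \<and>
     (\<forall>x. \<phi> (x, T) = 0)}"

text \<open>On \<open>\<real>\<^sup>n\<close> a locally finite Borel measure is automatically regular.\<close>

definition radon_measure :: "(real^'n) measure \<Rightarrow> bool" where
  "radon_measure \<mu> \<longleftrightarrow> sets \<mu> = sets borel \<and> (\<forall>K. compact K \<longrightarrow> emeasure \<mu> K < \<infinity>)"

definition weak_solution ::
  "real \<Rightarrow> ((real^'n) \<times> real \<Rightarrow> real) \<Rightarrow> (real^'n) measure \<Rightarrow> ((real^'n) \<times> real \<Rightarrow> real) \<Rightarrow> bool" where
  "weak_solution T V \<mu> u \<longleftrightarrow>
     radon_measure \<mu> \<and>
     u \<in> L1_loc (Qbar T) \<and>
     (\<lambda>z. V z * u z) \<in> L1_loc (Qbar T) \<and>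
     (\<forall>\<phi>\<in>X T. \<forall>g. backward_heat T \<phi> g \<longrightarrow>
        - (LINT z:Q T|lebesgue. u z * g z) + (LINT z:Q T|lebesgue. V z * u z * \<phi> z)
        = (LINT x|\<mu>. \<phi> (x, 0)))"

end

theory Submission
  imports Defs
begin

text \<open>
  The proof rests on Kato's inequality: where \<open>u\<close> solves \<open>\<partial>\<^sub>t u - \<Delta> u = - V u\<close> with
  \<open>V \<ge> 0\<close>, its absolute value is a subsolution of the heat equation. Since the initial datum is
  zero, the extension of \<open>u\<close> by zero to negative times satisfies the equation across \<open>t = 0\<close>, so
  that a test function need only vanish near the final time, and Kato's inequality becomes
  \<open>\<integral> \<bar>u\<bar> (\<partial>\<^sub>t \<phi> + \<Delta> \<phi>) \<ge> 0\<close> for every such \<open>\<phi> \<ge> 0\<close> (\<open>kato_inequality\<close>). It is obtained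
  by mollification: the mollified function \<open>w\<close> solves the equation with the mollified right-hand side,
  the convexity of \<open>j\<^sub>d(s) = sqrt (s\<^sup>2 + d\<^sup>2)\<close> gives
  \<open>\<Delta> j\<^sub>d(w) \<ge> j\<^sub>d'(w) \<Delta> w\<close>, and in the limit the term \<open>j\<^sub>d'(u) V u\<close> has the good sign.

  It remains to choose \<open>\<phi>\<close> (\<open>barrier_C21\<close>). For
  \<open>\<psi>(x, t) = exp (- \<alpha>(t) \<bar>x\<bar>\<^sup>2)\<close> one has
  \<open>\<partial>\<^sub>t \<psi> + \<Delta> \<psi> = ((4 \<alpha>\<^sup>2 - \<alpha>') \<bar>x\<bar>\<^sup>2 - 2 n \<alpha>) \<psi>\<close>, which is nonpositive as soon as
  \<open>\<alpha>' \<ge> 4 \<alpha>\<^sup>2\<close>. If the growth condition holds with rate \<open>\<kappa>\<close>, let \<open>\<alpha>\<close> be affine, growing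
  from \<open>2 \<kappa>\<close> at time \<open>s\<close> with slope \<open>64 \<kappa>\<^sup>2\<close>; it stays below \<open>4 \<kappa>\<close>, so that the inequality
  holds, for a time \<open>1 / (32 \<kappa>)\<close>. Multiply \<open>\<psi>\<close> by a cutoff in space at radius \<open>R\<close> and by a
  function of time that decreases to zero at a time \<open>r\<close>. The spatial cutoff costs
  \<open>O(R\<^sup>-\<^sup>2) exp (- \<kappa> \<bar>x\<bar>\<^sup>2)\<close>, which the growth condition integrates to something that tends to
  zero, while the decreasing time factor yields a strictly negative term. Letting \<open>R\<close> tend to infinity,
  \<open>u\<close> vanishes on \<open>s < t < r\<close> if it vanishes before \<open>s\<close> (\<open>uniqueness_step\<close>). The length of the time
  step depends on \<open>\<kappa>\<close> alone, so finitely many steps reach every time below \<open>T\<close>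
  (\<open>uniqueness_before\<close>).

  All cutoffs are built from \<open>max 0 y ^ 3\<close>, which is \<open>C\<^sup>2\<close>; this is enough, because the
  test functions of the weak formulation are only required to have a locally bounded heat operator.
\<close>

section \<open>Directional derivatives and integration by parts\<close>

text \<open>
  Every differentiation below is along a fixed direction, so that one-variable calculus suffices.
  Continuity of \<open>f\<close> is included because differentiability along a single direction does not imply it.
\<close>

definition has_dir_deriv :: "'a::euclidean_space \<Rightarrow> ('a \<Rightarrow> real) \<Rightarrow> ('a \<Rightarrow> real) \<Rightarrow> bool" where
  "has_dir_deriv v f f' \<longleftrightarrow> continuous_on UNIV f \<and> continuous_on UNIV f' \<and>
     (\<forall>z. ((\<lambda>s. f (z + s *\<^sub>R v)) has_real_derivative f' z) (at 0))"

lemma has_dir_deriv_line: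
  assumes "has_dir_deriv v f f'"
  shows "((\<lambda>s. f (z + s *\<^sub>R v)) has_real_derivative f' (z + t *\<^sub>R v)) (at t)"
proof -
  have "((\<lambda>s. f ((z + t *\<^sub>R v) + s *\<^sub>R v)) has_real_derivative f' (z + t *\<^sub>R v)) (at 0)"
    using assms by (auto simp: has_dir_deriv_def)
  then have "((\<lambda>s. f (z + (s + t) *\<^sub>R v)) has_real_derivative f' (z + t *\<^sub>R v)) (at 0)"
    by (simp add: algebra_simps)
  then show ?thesis
    using DERIV_shift[of "\<lambda>s. f (z + s *\<^sub>R v)" "f' (z + t *\<^sub>R v)" 0 t] by simp
qed

lemma has_dir_deriv_increment_le:
  assumes "has_dir_deriv v f f'" and "\<And>z. \<bar>f' z\<bar> \<le> B"
  shows "\<bar>f (z + s *\<^sub>R v) - f z\<bar> \<le> B * \<bar>s\<bar>"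
proof -
  have "norm (f (z + s *\<^sub>R v) - f (z + 0 *\<^sub>R v)) \<le> B * norm (s - 0)"
    by (rule field_differentiable_bound[where S=UNIV and f'="\<lambda>t. f' (z + t *\<^sub>R v)"])
       (use assms has_dir_deriv_line[OF assms(1)] in auto)
  then show ?thesis by simp
qed

lemma has_dir_deriv_mult:
  assumes "has_dir_deriv v f f'" "has_dir_deriv v g g'"
  shows "has_dir_deriv v (\<lambda>z. f z * g z) (\<lambda>z. f' z * g z + f z * g' z)"
  using assms unfolding has_dir_deriv_def
  by (auto intro!: continuous_intros derivative_eq_intros)

lemma has_dir_deriv_eq_0_off_support:
  assumes "has_dir_deriv v f f'" "closed K" "\<And>z. z \<notin> K \<Longrightarrow> f z = 0" "z \<notin> K"
  shows "f' z = 0"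
proof -
  have "open ((\<lambda>s. z + s *\<^sub>R v) -` (- K))"
    using assms(2) by (intro open_vimage continuous_intros) auto
  then have "\<forall>\<^sub>F s in nhds 0. s \<in> (\<lambda>s. z + s *\<^sub>R v) -` (- K)"
    using assms(4) by (intro eventually_nhds_in_open) auto
  then have "\<forall>\<^sub>F s in nhds 0. f (z + s *\<^sub>R v) = 0"
    by eventually_elim (use assms(3) in auto)
  then have "((\<lambda>s. 0) has_real_derivative f' z) (at 0)"
    using assms(1) DERIV_cong_ev[of 0 0 "\<lambda>s. f (z + s *\<^sub>R v)" "\<lambda>s. 0" "f' z" "f' z"]
    by (auto simp: has_dir_deriv_def)
  then show ?thesis by (metis DERIV_const DERIV_unique)
qed

lemma compact_support_bounded:
  fixes f :: "'a::euclidean_space \<Rightarrow> real"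
  assumes "continuous_on UNIV f" "compact K" "\<And>z. z \<notin> K \<Longrightarrow> f z = 0"
  obtains B where "B > 0" "\<And>z. \<bar>f z\<bar> \<le> B"
proof -
  have "bounded (f ` K)"
    using assms by (intro compact_imp_bounded compact_continuous_image continuous_on_subset[OF assms(1)]) auto
  then obtain B where "B > 0" "\<And>z. z \<in> K \<Longrightarrow> \<bar>f z\<bar> \<le> B"
    by (auto simp: bounded_pos)
  with assms(3) show ?thesis by (metis abs_zero less_eq_real_def that)
qed

lemma compact_support_integrable:
  fixes f :: "'a::euclidean_space \<Rightarrow> real"
  assumes "continuous_on UNIV f" "compact K" "\<And>z. z \<notin> K \<Longrightarrow> f z = 0"
  shows "integrable lborel f"
proof -
  have "(\<lambda>z. indicator K z *\<^sub>R f z) = f" using assms(3) by (force simp: indicator_def)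
  with borel_integrable_compact[of K f] assms show ?thesis
    by (metis continuous_on_subset top_greatest)
qed

lemma lborel_integral_shift:
  fixes f :: "'a::euclidean_space \<Rightarrow> real"
  assumes [measurable]: "f \<in> borel_measurable borel"
  shows "(\<integral>z. f (z + c) \<partial>lborel) = (\<integral>z. f z \<partial>lborel)"
  by (subst (2) lborel_distr_plus[of c, symmetric], subst integral_distr) (auto simp: add.commute)

lemma lborel_integrable_shift:
  fixes f :: "'a::euclidean_space \<Rightarrow> real"
  assumes "integrable lborel f"
  shows "integrable lborel (\<lambda>z. f (z + c))"
proof -
  have "integrable (distr lborel borel ((+) c)) f" using assms by (simp add: lborel_distr_plus)
  then have "integrable lborel (\<lambda>z. f (c + z))" by (rule integrable_distr[rotated]) auto
  then show ?thesis by (simp add: add.commute)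
qed

lemma integrable_indicator_cball [simp]:
  "integrable lborel (\<lambda>z. indicator (cball (a::'a::euclidean_space) R) z :: real)"
  by (intro integrable_real_indicator emeasure_bounded_finite) auto

text \<open>
  Lebesgue measure is translation invariant, so each difference quotient
  \<open>(f (z + s v) - f z) / s\<close> has integral zero. By the mean value theorem and the compact support these
  quotients are dominated by a multiple of the indicator of a ball, and dominated convergence gives the
  claim in every dimension and direction without an iterated integral.
\<close>

lemma integral_dir_deriv_eq_0:
  assumes dd: "has_dir_deriv v f f'" and K: "compact K" "\<And>z. z \<notin> K \<Longrightarrow> f z = 0"
  shows "(\<integral>z. f' z \<partial>lborel) = 0"
proof -
  have cf: "continuous_on UNIV f" and cf': "continuous_on UNIV f'"
    using dd by (auto simp: has_dir_deriv_def)
  note [measurable] = borel_measurable_continuous_onI[OF cf] borel_measurable_continuous_onI[OF cf']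
  have f'0: "f' z = 0" if "z \<notin> K" for z
    using has_dir_deriv_eq_0_off_support[OF dd compact_imp_closed[OF K(1)] K(2) that] .
  obtain B where B: "B > 0" "\<And>z. \<bar>f' z\<bar> \<le> B"
    using compact_support_bounded[OF cf' K(1) f'0] by blast
  obtain R where R: "\<And>z. z \<in> K \<Longrightarrow> norm z \<le> R"
    using compact_imp_bounded[OF K(1)] by (auto simp: bounded_iff)
  define q where "q k z = (f (z + (1 / Suc k) *\<^sub>R v) - f z) / (1 / Suc k)" for k z
  have fint: "integrable lborel f" by (rule compact_support_integrable[OF cf K])
  have "(\<lambda>k. \<integral>z. q k z \<partial>lborel) \<longlonglongrightarrow> (\<integral>z. f' z \<partial>lborel)"
  proof (rule integral_dominated_convergence[where w="\<lambda>z. B * indicator (cball 0 (R + norm v)) z"])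
    show "AE z in lborel. (\<lambda>k. q k z) \<longlonglongrightarrow> f' z"
    proof (rule AE_I2)
      fix z
      have "((\<lambda>s. (f (z + s *\<^sub>R v) - f z) / s) \<longlongrightarrow> f' z) (at 0)"
        using dd[unfolded has_dir_deriv_def] DERIV_def[of "\<lambda>s. f (z + s *\<^sub>R v)" "f' z" 0] by simp
      moreover have "filterlim (\<lambda>k. 1 / real (Suc k)) (at 0) sequentially"
        using LIMSEQ_inverse_real_of_nat by (auto simp: filterlim_at inverse_eq_divide)
      ultimately show "(\<lambda>k. q k z) \<longlonglongrightarrow> f' z"
        unfolding q_def by (rule filterlim_compose)
    qed
    show "AE z in lborel. norm (q k z) \<le> B * indicator (cball 0 (R + norm v)) z" for k
    proof (rule AE_I2)
      fix z
      show "norm (q k z) \<le> B * indicator (cball 0 (R + norm v)) z"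
      proof (cases "norm z \<le> R + norm v")
        case True
        have "\<bar>f (z + (1 / Suc k) *\<^sub>R v) - f z\<bar> \<le> B * \<bar>1 / Suc k\<bar>"
          using has_dir_deriv_increment_le[OF dd B(2)] .
        then have "\<bar>f (z + (1 / Suc k) *\<^sub>R v) - f z\<bar> / (1 / Suc k) \<le> B"
          by (subst pos_divide_le_eq) auto
        with True show ?thesis by (simp add: q_def abs_mult)
      next
        case False
        have "z \<notin> K" using R[of z] False norm_ge_zero[of v] by linarith
        moreover have "z + (1 / Suc k) *\<^sub>R v \<notin> K"
        proof
          assume "z + (1 / Suc k) *\<^sub>R v \<in> K"
          then have "norm (z + (1 / Suc k) *\<^sub>R v) \<le> R" by (rule R)
          moreover have "norm z \<le> norm (z + (1 / Suc k) *\<^sub>R v) + norm ((1 / Suc k) *\<^sub>R v)"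
            using norm_triangle_sub[of z "- ((1 / Suc k) *\<^sub>R v)"] by (simp add: norm_minus_cancel)
          moreover have "norm ((1 / Suc k) *\<^sub>R v) \<le> norm v"
            by (simp add: field_simps mult_left_le_one_le)
          ultimately show False using False by linarith
        qed
        ultimately show ?thesis using K(2) B by (simp add: q_def)
      qed
    qed
  qed (auto simp: q_def)
  moreover have "(\<integral>z. q k z \<partial>lborel) = 0" for k
    unfolding q_def
    by (subst integral_divide_zero, subst Bochner_Integration.integral_diff)
       (auto intro: lborel_integrable_shift fint simp: lborel_integral_shift)
  ultimately show ?thesis by (simp add: LIMSEQ_const_iff)
qed

lemma integration_by_parts:
  assumes f: "has_dir_deriv v f f'" and g: "has_dir_deriv v g g'"
    and K: "compact K" "\<And>z. z \<notin> K \<Longrightarrow> g z = 0"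
  shows "(\<integral>z. f z * g' z \<partial>lborel) = - (\<integral>z. f' z * g z \<partial>lborel)"
proof -
  have g'0: "g' z = 0" if "z \<notin> K" for z
    using has_dir_deriv_eq_0_off_support[OF g compact_imp_closed[OF K(1)] K(2) that] .
  have "(\<integral>z. f' z * g z + f z * g' z \<partial>lborel) = 0"
    using integral_dir_deriv_eq_0[OF has_dir_deriv_mult[OF f g] K(1)] K(2) by simp
  moreover have "integrable lborel (\<lambda>z. f' z * g z)" "integrable lborel (\<lambda>z. f z * g' z)"
    using f g K g'0 unfolding has_dir_deriv_def
    by (intro compact_support_integrable[OF _ K(1)] continuous_intros; simp)+
  ultimately show ?thesis by simp
qed

text \<open>
  The class \<open>C\<^sup>2\<close> in space and \<open>C\<^sup>1\<close> in time: \<open>a\<close> is the time derivative of \<open>f\<close> and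
  \<open>b\<close> is its spatial Laplacian. Naming both avoids derivative operators and their differentiability side
  conditions.
\<close>

definition C21 :: "((real^'n) \<times> real \<Rightarrow> real) \<Rightarrow> ((real^'n) \<times> real \<Rightarrow> real) \<Rightarrow>
    ((real^'n) \<times> real \<Rightarrow> real) \<Rightarrow> bool" where
  "C21 f a b \<longleftrightarrow> has_dir_deriv (0, 1) f a \<and>
     (\<exists>D E. (\<forall>i. has_dir_deriv (axis i 1, 0) f (D i) \<and> has_dir_deriv (axis i 1, 0) (D i) (E i)) \<and>
       b = (\<lambda>z. \<Sum>i\<in>UNIV. E i z))"

lemma C21_continuous:
  assumes "C21 f a b"
  shows "continuous_on UNIV f" "continuous_on UNIV a" "continuous_on UNIV b"
  using assms unfolding C21_def has_dir_deriv_def by (auto intro!: continuous_intros)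

lemma C21_eq_0_off_support:
  assumes "C21 f a b" "closed K" "\<And>z. z \<notin> K \<Longrightarrow> f z = 0" "z \<notin> K"
  shows "a z = 0" "b z = 0"
proof -
  obtain D E where D: "has_dir_deriv (0, 1) f a" "\<And>i. has_dir_deriv (axis i 1, 0) f (D i)"
     "\<And>i. has_dir_deriv (axis i 1, 0) (D i) (E i)" "b = (\<lambda>z. \<Sum>i\<in>UNIV. E i z)"
    using assms(1) unfolding C21_def by auto
  show "a z = 0" using has_dir_deriv_eq_0_off_support[OF D(1) assms(2-4)] by simp
  have "E i z = 0" for i
    using has_dir_deriv_eq_0_off_support[OF D(3) assms(2) _ assms(4)]
       has_dir_deriv_eq_0_off_support[OF D(2) assms(2,3)] by blast
  then show "b z = 0" by (simp add: D(4))
qed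

lemma green_parts:
  assumes f: "C21 f a b" and g: "C21 g a' b'"
    and K: "compact K" "\<And>z. z \<notin> K \<Longrightarrow> g z = 0"
  shows "(\<integral>z. f z * a' z \<partial>lborel) = - (\<integral>z. a z * g z \<partial>lborel)"
    and "(\<integral>z. f z * b' z \<partial>lborel) = (\<integral>z. b z * g z \<partial>lborel)"
proof -
  obtain D E where D: "has_dir_deriv (0, 1) f a" "\<And>i. has_dir_deriv (axis i 1, 0) f (D i)"
     "\<And>i. has_dir_deriv (axis i 1, 0) (D i) (E i)" "b = (\<lambda>z. \<Sum>i\<in>UNIV. E i z)"
    using f unfolding C21_def by auto
  obtain D' E' where D': "has_dir_deriv (0, 1) g a'" "\<And>i. has_dir_deriv (axis i 1, 0) g (D' i)"
     "\<And>i. has_dir_deriv (axis i 1, 0) (D' i) (E' i)" "b' = (\<lambda>z. \<Sum>i\<in>UNIV. E' i z)"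
    using g unfolding C21_def by auto
  note cl = compact_imp_closed[OF K(1)]
  have D0: "D' i z = 0" if "z \<notin> K" for i z
    using has_dir_deriv_eq_0_off_support[OF D'(2) cl K(2) that] .
  have E0: "E' i z = 0" if "z \<notin> K" for i z
    using has_dir_deriv_eq_0_off_support[OF D'(3) cl D0 that] .
  have i: "(\<integral>z. f z * E' i z \<partial>lborel) = (\<integral>z. E i z * g z \<partial>lborel)" for i
    using integration_by_parts[OF D(2) D'(3) K(1) D0]
       integration_by_parts[OF D(3) D'(2) K] by (metis minus_minus)
  show "(\<integral>z. f z * a' z \<partial>lborel) = - (\<integral>z. a z * g z \<partial>lborel)"
    by (rule integration_by_parts[OF D(1) D'(1) K])
  have c: "continuous_on UNIV (E' i)" "continuous_on UNIV (E i)" for i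
    using D(3) D'(3) by (auto simp: has_dir_deriv_def)
  note cc = C21_continuous[OF f] C21_continuous[OF g]
  have int: "integrable lborel (\<lambda>z. f z * E' i z)" "integrable lborel (\<lambda>z. E i z * g z)" for i
    using K(2) E0 by (intro compact_support_integrable[OF _ K(1)] continuous_intros cc c; simp)+
  show "(\<integral>z. f z * b' z \<partial>lborel) = (\<integral>z. b z * g z \<partial>lborel)"
    using int by (simp add: D(4) D'(4) sum_distrib_left sum_distrib_right i)
qed

text \<open>
  The derivatives move onto the compactly supported factor \<open>g\<close> in the first identity and away
  from it in the second: one characterises distributional derivatives, the other evaluates a weak formulation.
\<close>

lemma green_identity:
  assumes f: "C21 f a b" and g: "C21 g a' b'"
    and K: "compact K" "\<And>z. z \<notin> K \<Longrightarrow> g z = 0"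
  shows "(\<integral>z. (a z + b z) * g z \<partial>lborel) = (\<integral>z. f z * (- a' z + b' z) \<partial>lborel)"
    and "(\<integral>z. (a' z + b' z) * f z \<partial>lborel) = (\<integral>z. g z * (- a z + b z) \<partial>lborel)"
proof -
  note cc = C21_continuous[OF f] C21_continuous[OF g]
  note z = K(2) C21_eq_0_off_support[OF g compact_imp_closed[OF K(1)] K(2)]
  have int: "integrable lborel (\<lambda>z. f z * a' z)" "integrable lborel (\<lambda>z. a z * g z)"
     "integrable lborel (\<lambda>z. f z * b' z)" "integrable lborel (\<lambda>z. b z * g z)" 
    using z by (intro compact_support_integrable[OF _ K(1)] continuous_intros cc; simp)+
  note p = green_parts[OF f g K]
  have "(\<integral>z. (a z + b z) * g z \<partial>lborel) = (\<integral>z. a z * g z \<partial>lborel) + (\<integral>z. b z * g z \<partial>lborel)"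
    using int by (simp add: distrib_right)
  also have "\<dots> = (\<integral>z. f z * b' z - f z * a' z \<partial>lborel)" using int by (simp add: p)
  finally show "(\<integral>z. (a z + b z) * g z \<partial>lborel) = (\<integral>z. f z * (- a' z + b' z) \<partial>lborel)"
    by (simp add: right_diff_distrib)
  have "(\<integral>z. (a' z + b' z) * f z \<partial>lborel) = (\<integral>z. f z * a' z + f z * b' z \<partial>lborel)"
    by (simp add: algebra_simps)
  also have "\<dots> = (\<integral>z. b z * g z - a z * g z \<partial>lborel)" using int by (simp add: p)
  finally show "(\<integral>z. (a' z + b' z) * f z \<partial>lborel) = (\<integral>z. g z * (- a z + b z) \<partial>lborel)"
    by (simp add: algebra_simps)
qed

section \<open>Convex regularisation of the absolute value\<close>

definition smooth_abs :: "real \<Rightarrow> real \<Rightarrow> real" where "smooth_abs d s = sqrt (s\<^sup>2 + d\<^sup>2)"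
definition smooth_sgn :: "real \<Rightarrow> real \<Rightarrow> real" where "smooth_sgn d s = s / sqrt (s\<^sup>2 + d\<^sup>2)"

lemma sum_squares_pos_right: "d > 0 \<Longrightarrow> s\<^sup>2 + d\<^sup>2 > (0::real)"
  by (simp add: add_nonneg_pos)

lemma smooth_abs_deriv: "d > 0 \<Longrightarrow> (smooth_abs d has_real_derivative smooth_sgn d s) (at s)"
  unfolding smooth_abs_def smooth_sgn_def
  using sum_squares_pos_right[of d s] by (auto intro!: derivative_eq_intros simp: field_simps)

lemma smooth_sgn_deriv:
  assumes "d > 0"
  shows "(smooth_sgn d has_real_derivative d\<^sup>2 / sqrt (s\<^sup>2 + d\<^sup>2) ^ 3) (at s)"
proof -
  define r where "r = sqrt (s\<^sup>2 + d\<^sup>2)"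
  have r: "r > 0" "r\<^sup>2 = s\<^sup>2 + d\<^sup>2" using sum_squares_pos_right[OF assms, of s] by (auto simp: r_def)
  have "(smooth_sgn d has_real_derivative (1 * sqrt (s\<^sup>2 + d\<^sup>2) - s * smooth_sgn d s) / (sqrt (s\<^sup>2 + d\<^sup>2) * sqrt (s\<^sup>2 + d\<^sup>2))) (at s)"
    unfolding smooth_sgn_def[abs_def]
    using sum_squares_pos_right[OF assms, of s] smooth_abs_deriv[OF assms, of s, unfolded smooth_abs_def[abs_def]]
    by (intro DERIV_divide DERIV_ident) (auto simp: smooth_sgn_def)
  also have "(1 * sqrt (s\<^sup>2 + d\<^sup>2) - s * smooth_sgn d s) / (sqrt (s\<^sup>2 + d\<^sup>2) * sqrt (s\<^sup>2 + d\<^sup>2))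
      = (r\<^sup>2 - s\<^sup>2) / r ^ 3"
    unfolding smooth_sgn_def r_def[symmetric]
    using r(1) by (simp add: divide_simps power2_eq_square power3_eq_cube)
  also have "\<dots> = d\<^sup>2 / r ^ 3" using r by simp
  finally show ?thesis by (simp add: r_def)
qed

lemma abs_smooth_sgn_le: "\<bar>smooth_sgn d s\<bar> \<le> 1"
proof (cases "s\<^sup>2 + d\<^sup>2 = 0")
  case False
  then have p: "s\<^sup>2 + d\<^sup>2 > 0" by (smt (verit) zero_le_power2)
  have "\<bar>s\<bar> \<le> sqrt (s\<^sup>2 + d\<^sup>2)" by (rule real_le_rsqrt) simp
  moreover have "sqrt (s\<^sup>2 + d\<^sup>2) > 0" using p by simp
  ultimately show ?thesis unfolding smooth_sgn_def abs_divide by (subst divide_le_eq_1_pos) auto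
qed (simp add: smooth_sgn_def)

lemma smooth_abs_lipschitz:
  assumes "d > 0" shows "\<bar>smooth_abs d s - smooth_abs d t\<bar> \<le> \<bar>s - t\<bar>"
proof -
  have "norm (smooth_abs d s - smooth_abs d t) \<le> 1 * norm (s - t)"
    by (rule field_differentiable_bound[where S=UNIV and f'="smooth_sgn d"])
       (use smooth_abs_deriv[OF assms] abs_smooth_sgn_le in auto)
  then show ?thesis by simp
qed

lemma smooth_abs_near_abs:
  assumes "d > 0" shows "\<bar>smooth_abs d s - \<bar>s\<bar>\<bar> \<le> d"
proof -
  have "\<bar>s\<bar> \<le> smooth_abs d s"
    unfolding smooth_abs_def by (rule real_le_rsqrt) simp
  moreover have "smooth_abs d s \<le> \<bar>s\<bar> + d"
    unfolding smooth_abs_def using assms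
    by (intro real_le_lsqrt) (auto simp: power2_sum)
  ultimately show ?thesis by linarith
qed

lemma has_dir_deriv_compose:
  assumes f: "has_dir_deriv v f f'" and j: "\<And>s. (j has_real_derivative j' s) (at s)"
    and c: "continuous_on UNIV j'"
  shows "has_dir_deriv v (\<lambda>z. j (f z)) (\<lambda>z. j' (f z) * f' z)"
proof -
  have cj: "continuous_on UNIV j" using j by (meson DERIV_isCont continuous_at_imp_continuous_on)
  have "((\<lambda>s. j (f (z + s *\<^sub>R v))) has_real_derivative j' (f z) * f' z) (at 0)" for z
    using DERIV_chain2[of j "j' (f z)" "\<lambda>s. f (z + s *\<^sub>R v)" 0 "f' z" UNIV] j f
    by (auto simp: has_dir_deriv_def)
  then show ?thesis using f cj c unfolding has_dir_deriv_def
    by (auto intro!: continuous_intros continuous_on_compose2[of UNIV j] continuous_on_compose2[of UNIV j'])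
qed

lemma has_dir_deriv_minus: "has_dir_deriv v f f' \<Longrightarrow> has_dir_deriv v (\<lambda>z. - f z) (\<lambda>z. - f' z)"
  unfolding has_dir_deriv_def by (auto intro!: continuous_intros derivative_eq_intros)

text \<open>
  Differentiating twice, \<open>\<Delta> j(w) = j'(w) \<Delta> w + j''(w) \<bar>\<nabla> w\<bar>\<^sup>2\<close>, and the last term is
  nonnegative because \<open>j = smooth_abs d\<close> is convex. This is the pointwise form of Kato's inequality.
\<close>

lemma smooth_abs_subsolution:
  assumes w: "C21 w a b" and d: "d > 0"
  obtains b' where "C21 (\<lambda>z. smooth_abs d (w z)) (\<lambda>z. smooth_sgn d (w z) * a z) b'"
     "\<And>z. b' z \<ge> smooth_sgn d (w z) * b z"
proof -
  obtain D E where D: "has_dir_deriv (0, 1) w a" "\<And>i. has_dir_deriv (axis i 1, 0) w (D i)"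
     "\<And>i. has_dir_deriv (axis i 1, 0) (D i) (E i)" "b = (\<lambda>z. \<Sum>i\<in>UNIV. E i z)"
    using w unfolding C21_def by auto
  let ?k = "\<lambda>s. d\<^sup>2 / sqrt (s\<^sup>2 + d\<^sup>2) ^ 3"
  have nz: "sqrt (s\<^sup>2 + d\<^sup>2) \<noteq> 0" for s using d by simp
  have c1: "continuous_on UNIV (smooth_sgn d)"
    using smooth_sgn_deriv[OF d] by (meson DERIV_isCont continuous_at_imp_continuous_on)
  have c2: "continuous_on UNIV ?k" 
    by (intro continuous_intros) (use nz in auto)
  note f1 = has_dir_deriv_compose[OF _ smooth_abs_deriv[OF d] c1]
  note f2 = has_dir_deriv_mult[OF has_dir_deriv_compose[OF D(2) smooth_sgn_deriv[OF d] c2] D(3)]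
  let ?E = "\<lambda>i z. ?k (w z) * D i z * D i z + smooth_sgn d (w z) * E i z"
  have "C21 (\<lambda>z. smooth_abs d (w z)) (\<lambda>z. smooth_sgn d (w z) * a z) (\<lambda>z. \<Sum>i\<in>UNIV. ?E i z)"
    unfolding C21_def using f1[OF D(1)] f1[OF D(2)] f2 
    by (intro conjI exI[of _ "\<lambda>i z. smooth_sgn d (w z) * D i z"] exI[of _ ?E]) auto
  moreover have "(\<Sum>i\<in>UNIV. ?E i z) \<ge> smooth_sgn d (w z) * b z" for z
    unfolding D(4) sum_distrib_left
    by (intro sum_mono) (simp add: mult.assoc flip: power2_eq_square)
  ultimately show thesis by (rule that)
qed


section \<open>Convolution with a compactly supported kernel\<close>

definition convolution :: "('a::euclidean_space \<Rightarrow> real) \<Rightarrow> ('a \<Rightarrow> real) \<Rightarrow> 'a \<Rightarrow> real" where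
  "convolution U \<rho> z = (\<integral>y. U y * \<rho> (z - y) \<partial>lborel)"

lemma integrable_mult_bounded:
  fixes U f :: "'a::euclidean_space \<Rightarrow> real"
  assumes U: "integrable lborel U" and [measurable]: "f \<in> borel_measurable borel" and B: "\<And>z. \<bar>f z\<bar> \<le> B"
  shows "integrable lborel (\<lambda>z. U z * f z)"
proof (rule Bochner_Integration.integrable_bound[where f="\<lambda>z. B * \<bar>U z\<bar>"])
  have "\<bar>f z\<bar> \<le> \<bar>B\<bar>" for z using B[of z] by linarith
  then show "AE z in lborel. norm (U z * f z) \<le> norm (B * \<bar>U z\<bar>)"
    by (auto simp: abs_mult mult.commute[of "\<bar>U _\<bar>"] intro!: AE_I2 mult_right_mono)
qed (use U in auto)

lemma convolution_integrable:
  fixes U \<rho> :: "'a::euclidean_space \<Rightarrow> real"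
  assumes "integrable lborel U" "continuous_on UNIV \<rho>" "\<And>z. \<bar>\<rho> z\<bar> \<le> B"
  shows "integrable lborel (\<lambda>y. U y * \<rho> (z - y))"
proof (rule integrable_mult_bounded[OF assms(1), where B=B])
  show "(\<lambda>y. \<rho> (z - y)) \<in> borel_measurable borel"
    by (intro borel_measurable_continuous_onI continuous_on_compose2[OF assms(2)] continuous_intros) auto
qed (rule assms(3))

lemma continuous_convolution:
  assumes U: "integrable lborel U" and c: "continuous_on UNIV \<rho>" and B: "\<And>z. \<bar>\<rho> z\<bar> \<le> B"
  shows "continuous_on UNIV (convolution U \<rho>)"
proof -
  have [measurable]: "\<rho> \<in> borel_measurable borel" using c by (rule borel_measurable_continuous_onI)
  note [measurable] = U
  have "(\<lambda>n. convolution U \<rho> (X n)) \<longlonglongrightarrow> convolution U \<rho> x" if X: "X \<longlonglongrightarrow> x" for X x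
    unfolding convolution_def
  proof (rule integral_dominated_convergence[where w="\<lambda>y. B * \<bar>U y\<bar>"])
    show "AE y in lborel. norm (U y * \<rho> (X i - y)) \<le> B * \<bar>U y\<bar>" for i
      by (intro AE_I2) (subst real_norm_def, subst abs_mult, subst mult.commute, rule mult_right_mono, auto intro: B)
    show "AE y in lborel. (\<lambda>n. U y * \<rho> (X n - y)) \<longlonglongrightarrow> U y * \<rho> (x - y)"
      by (intro AE_I2 tendsto_intros isCont_tendsto_compose[of _ \<rho>] X) 
         (use c in \<open>auto simp: continuous_on_eq_continuous_at\<close>)
  qed (use U in auto)
  then show ?thesis by (simp add: continuous_on_sequentially comp_def)
qed

text \<open>
  The difference quotients of the kernel are bounded by the mean value theorem, so differentiation
  under the integral is dominated by a multiple of \<open>\<bar>U\<bar>\<close>.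
\<close>

lemma convolution_has_dir_deriv:
  assumes U: "integrable lborel U" and dd: "has_dir_deriv v \<rho> \<rho>'"
    and B: "\<And>z. \<bar>\<rho> z\<bar> \<le> B" "\<And>z. \<bar>\<rho>' z\<bar> \<le> B"
  shows "has_dir_deriv v (convolution U \<rho>) (convolution U \<rho>')"
proof -
  have c: "continuous_on UNIV \<rho>" "continuous_on UNIV \<rho>'" using dd by (auto simp: has_dir_deriv_def)
  note [measurable] = U borel_measurable_continuous_onI[OF c(1)] borel_measurable_continuous_onI[OF c(2)]
  note I = convolution_integrable[OF U c(1) B(1)]
  have "((\<lambda>s. convolution U \<rho> (z + s *\<^sub>R v)) has_real_derivative convolution U \<rho>' z) (at 0)" for z
    unfolding DERIV_def tendsto_at_iff_sequentially comp_def
  proof (intro allI impI)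
    fix X :: "nat \<Rightarrow> real" assume X: "\<forall>i. X i \<in> UNIV - {0}" "X \<longlonglongrightarrow> 0"
    then have nz: "X i \<noteq> 0" for i by auto
    have "(\<lambda>i. \<integral>y. U y * ((\<rho> (z + X i *\<^sub>R v - y) - \<rho> (z - y)) / X i) \<partial>lborel) \<longlonglongrightarrow> convolution U \<rho>' z"
      unfolding convolution_def
    proof (rule integral_dominated_convergence[where w="\<lambda>y. B * \<bar>U y\<bar>"])
      fix i
      have "\<bar>\<rho> (z + X i *\<^sub>R v - y) - \<rho> (z - y)\<bar> \<le> B * \<bar>X i\<bar>" for y
        using has_dir_deriv_increment_le[OF dd B(2), of "z - y" "X i"] by (simp add: algebra_simps)
      then have "\<bar>(\<rho> (z + X i *\<^sub>R v - y) - \<rho> (z - y)) / X i\<bar> \<le> B" for y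
        using nz[of i] by (simp add: abs_divide pos_divide_le_eq)
      then show "AE y in lborel. norm (U y * ((\<rho> (z + X i *\<^sub>R v - y) - \<rho> (z - y)) / X i)) \<le> B * \<bar>U y\<bar>"
        by (intro AE_I2) (subst real_norm_def, subst abs_mult, subst mult.commute, rule mult_right_mono, auto)
    next
      show "AE y in lborel. (\<lambda>i. U y * ((\<rho> (z + X i *\<^sub>R v - y) - \<rho> (z - y)) / X i)) \<longlonglongrightarrow> U y * \<rho>' (z - y)"
      proof (intro AE_I2 tendsto_intros)
        fix y
        have "((\<lambda>s. \<rho> ((z - y) + s *\<^sub>R v)) has_real_derivative \<rho>' (z - y)) (at 0)"
          using dd by (auto simp: has_dir_deriv_def)
        then have "(\<lambda>i. (\<rho> ((z - y) + X i *\<^sub>R v) - \<rho> (z - y)) / X i) \<longlonglongrightarrow> \<rho>' (z - y)"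
          using X by (auto simp: DERIV_def tendsto_at_iff_sequentially comp_def)
        then show "(\<lambda>i. (\<rho> (z + X i *\<^sub>R v - y) - \<rho> (z - y)) / X i) \<longlonglongrightarrow> \<rho>' (z - y)"
          by (simp add: algebra_simps)
      qed
    qed (use U in auto)
    moreover have "(\<integral>y. (U y * \<rho> (z + X i *\<^sub>R v - y) - U y * \<rho> (z - y)) / X i \<partial>lborel)
       = (convolution U \<rho> (z + (0 + X i) *\<^sub>R v) - convolution U \<rho> (z + 0 *\<^sub>R v)) / X i" for i
      unfolding convolution_def using I by (subst integral_divide_zero, subst Bochner_Integration.integral_diff) auto
    ultimately show "(\<lambda>i. (convolution U \<rho> (z + (0 + X i) *\<^sub>R v) - convolution U \<rho> (z + 0 *\<^sub>R v)) / X i) \<longlonglongrightarrow> convolution U \<rho>' z"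
      using nz by (simp add: right_diff_distrib)
  qed
  moreover have "continuous_on UNIV (convolution U \<rho>)" "continuous_on UNIV (convolution U \<rho>')"
    using continuous_convolution[OF U] c B by auto
  ultimately show ?thesis unfolding has_dir_deriv_def by blast
qed

lemma convolution_C21:
  assumes U: "integrable lborel U" and \<rho>: "C21 \<rho> a b"
    and K: "compact K" "\<And>z. z \<notin> K \<Longrightarrow> \<rho> z = 0"
  shows "C21 (convolution U \<rho>) (convolution U a) (convolution U b)"
proof -
  obtain D E where D: "has_dir_deriv (0, 1) \<rho> a" "\<And>i. has_dir_deriv (axis i 1, 0) \<rho> (D i)"
     "\<And>i. has_dir_deriv (axis i 1, 0) (D i) (E i)" "b = (\<lambda>z. \<Sum>i\<in>UNIV. E i z)"
    using \<rho> unfolding C21_def by auto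
  note cl = compact_imp_closed[OF K(1)]
  have key: "has_dir_deriv v (convolution U f) (convolution U f')" "\<exists>B. \<forall>z. \<bar>f' z\<bar> \<le> B" "\<And>z. z \<notin> K \<Longrightarrow> f' z = 0"
    if f: "has_dir_deriv v f f'" "\<And>z. z \<notin> K \<Longrightarrow> f z = 0" for v f f'
  proof -
    show 1: "f' z = 0" if "z \<notin> K" for z using has_dir_deriv_eq_0_off_support[OF f(1) cl f(2) that] .
    have c: "continuous_on UNIV f" "continuous_on UNIV f'" using f(1) by (auto simp: has_dir_deriv_def)
    obtain B1 where B1: "\<And>z. \<bar>f z\<bar> \<le> B1"
      using compact_support_bounded[OF c(1) K(1) f(2)] by blast
    obtain B2 where B2: "\<And>z. \<bar>f' z\<bar> \<le> B2"
      using compact_support_bounded[OF c(2) K(1) 1] by blast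
    show "\<exists>B. \<forall>z. \<bar>f' z\<bar> \<le> B" using B2 by blast
    show "has_dir_deriv v (convolution U f) (convolution U f')"
      by (rule convolution_has_dir_deriv[OF U f(1), where B="max B1 B2"]) (use B1 B2 in \<open>auto simp: le_max_iff_disj\<close>)
  qed
  have D0: "z \<notin> K \<Longrightarrow> D i z = 0" for i z using key(3)[OF D(2) K(2)] .
  have "integrable lborel (\<lambda>y. U y * E i (z - y))" for i z
  proof -
    obtain B where "\<And>z. \<bar>E i z\<bar> \<le> B" using key(2)[OF D(3) D0, of i] by blast
    then show ?thesis using convolution_integrable[OF U, of "E i" B z] D(3)[of i] unfolding has_dir_deriv_def by blast
  qed
  then have "convolution U b = (\<lambda>z. \<Sum>i\<in>UNIV. convolution U (E i) z)"
    unfolding D(4) convolution_def by (simp add: sum_distrib_left)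
  then show ?thesis
    unfolding C21_def
    by (intro conjI exI[of _ "\<lambda>i. convolution U (D i)"] exI[of _ "\<lambda>i. convolution U (E i)"] allI
        key(1)[OF D(1) K(2)] key(1)[OF D(2) K(2)] key(1)[OF D(3) D0])
qed

lemma has_dir_deriv_reflect:
  assumes "has_dir_deriv v f f'" shows "has_dir_deriv v (\<lambda>y. f (z - y)) (\<lambda>y. - f' (z - y))"
proof -
  have "((\<lambda>s. f ((z - y) + s *\<^sub>R v)) has_real_derivative f' (z - y)) (at (- 0))" for y
    using assms by (auto simp: has_dir_deriv_def)
  then have "((\<lambda>s. f ((z - y) + (- s) *\<^sub>R v)) has_real_derivative - f' (z - y)) (at 0)" for y
    using DERIV_mirror[of "\<lambda>s. f ((z - y) + s *\<^sub>R v)" "f' (z - y)" 0] by simp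
  then show ?thesis using assms unfolding has_dir_deriv_def
    by (auto intro!: continuous_intros continuous_on_compose2[of UNIV f] continuous_on_compose2[of UNIV f'] simp: algebra_simps)
qed

text \<open>
  Evaluating a convolution at \<open>z\<close> means testing with the reflected kernel \<open>y \<mapsto> \<rho> (z - y)\<close>. The
  reflection changes the sign of the time derivative but not of the Laplacian, which turns the backward heat
  operator on the test function into minus the forward one on the mollification.
\<close>

lemma C21_reflect:
  assumes "C21 f a b" shows "C21 (\<lambda>y. f (z - y)) (\<lambda>y. - a (z - y)) (\<lambda>y. b (z - y))"
proof -
  obtain D E where D: "has_dir_deriv (0, 1) f a" "\<And>i. has_dir_deriv (axis i 1, 0) f (D i)"
     "\<And>i. has_dir_deriv (axis i 1, 0) (D i) (E i)" "b = (\<lambda>z. \<Sum>i\<in>UNIV. E i z)"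
    using assms unfolding C21_def by auto
  have "has_dir_deriv (axis i 1, 0) (\<lambda>y. - D i (z - y)) (\<lambda>y. E i (z - y))" for i
    using has_dir_deriv_minus[OF has_dir_deriv_reflect[OF D(3)[of i], of z]] by simp
  then show ?thesis
    unfolding C21_def
    by (intro conjI exI[of _ "\<lambda>i y. - D i (z - y)"] exI[of _ "\<lambda>i y. E i (z - y)"])
       (use D(4) has_dir_deriv_reflect[OF D(1)] has_dir_deriv_reflect[OF D(2)] in auto)
qed

section \<open>Radial functions and mollifiers\<close>

text \<open>
  A positive part to a power of at least two is continuously differentiable; at the origin this holds
  because the function is bounded there by \<open>\<bar>h\<bar> ^ Suc k\<close> times \<open>\<bar>h\<bar>\<close>.
\<close>

lemma pos_part_power_deriv:
  "((\<lambda>y::real. max 0 y ^ Suc (Suc k)) has_real_derivative real (Suc (Suc k)) * max 0 y ^ Suc k) (at y)"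
proof -
  consider "y > 0" | "y < 0" | "y = 0" by linarith
  then show ?thesis
  proof cases
    case 1
    have h: "((\<lambda>y::real. y ^ Suc (Suc k)) has_real_derivative real (Suc (Suc k)) * y ^ Suc k) (at y)"
      using DERIV_pow[of "Suc (Suc k)" y] by simp
    have "\<forall>\<^sub>F x in nhds y. x \<in> {0<..}" using 1 by (intro eventually_nhds_in_open) auto
    then have "\<forall>\<^sub>F x in nhds y. x ^ Suc (Suc k) = max 0 x ^ Suc (Suc k)" by eventually_elim auto
    from DERIV_cong_ev[OF refl this refl, THEN iffD1, OF h] show ?thesis using 1 by simp
  next
    case 2
    have "\<forall>\<^sub>F x in nhds y. x \<in> {..<0}" using 2 by (intro eventually_nhds_in_open) auto
    then have "\<forall>\<^sub>F x in nhds y. 0 = max 0 x ^ Suc (Suc k)" by eventually_elim auto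
    from DERIV_cong_ev[OF refl this refl, THEN iffD1, OF DERIV_const] show ?thesis using 2 by simp
  next
    case 3
    have c: "((\<lambda>h::real. \<bar>h\<bar> ^ Suc k) \<longlongrightarrow> 0) (at 0)"
      by (rule tendsto_eq_intros | simp)+
    have "((\<lambda>h::real. (max 0 (0 + h) ^ Suc (Suc k) - max 0 0 ^ Suc (Suc k)) / h) \<longlongrightarrow> 0) (at 0)"
    proof (rule Lim_null_comparison[OF _ c], rule always_eventually, rule allI)
      fix h :: real
      show "norm ((max 0 (0 + h) ^ Suc (Suc k) - max 0 0 ^ Suc (Suc k)) / h) \<le> \<bar>h\<bar> ^ Suc k"
      proof (cases "h > 0")
        case True
        then show ?thesis by (simp add: max_def abs_mult)
      next
        case False
        then have m: "max 0 (0 + h) = 0" by simp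
        have "0 \<le> \<bar>h\<bar> ^ Suc k" by (rule zero_le_power) simp
        then show ?thesis unfolding m by (simp only: max.idem diff_self div_0 norm_zero)
      qed
    qed
    then show ?thesis using 3 by (simp add: DERIV_def)
  qed
qed

definition pos_cube :: "real \<Rightarrow> real" where "pos_cube y = max 0 y ^ 3"
definition pos_cube' :: "real \<Rightarrow> real" where "pos_cube' y = 3 * max 0 y ^ 2"
definition pos_cube'' :: "real \<Rightarrow> real" where "pos_cube'' y = 6 * max 0 y"

lemma pos_cube_deriv: "(pos_cube has_real_derivative pos_cube' y) (at y)"
  using pos_part_power_deriv[of 1 y] by (simp add: pos_cube_def[abs_def] pos_cube'_def eval_nat_numeral)

lemma pos_cube'_deriv: "(pos_cube' has_real_derivative pos_cube'' y) (at y)"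
  using DERIV_cmult[OF pos_part_power_deriv[of 0 y], of 3]
  by (simp add: pos_cube'_def[abs_def] pos_cube''_def eval_nat_numeral)

lemma pos_cube_simps: "pos_cube y \<ge> 0" "pos_cube' y \<ge> 0" "pos_cube'' y \<ge> 0"
  "y \<le> 0 \<Longrightarrow> pos_cube y = 0" "y \<le> 0 \<Longrightarrow> pos_cube' y = 0" "y \<le> 0 \<Longrightarrow> pos_cube'' y = 0"
  "y > 0 \<Longrightarrow> pos_cube y > 0" "y > 0 \<Longrightarrow> pos_cube' y > 0"
  by (auto simp: pos_cube_def pos_cube'_def pos_cube''_def max_def)

lemma continuous_pos_cube:
  "continuous_on S f \<Longrightarrow> continuous_on S (\<lambda>x. pos_cube (f x))"
  "continuous_on S f \<Longrightarrow> continuous_on S (\<lambda>x. pos_cube' (f x))"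
  "continuous_on S f \<Longrightarrow> continuous_on S (\<lambda>x. pos_cube'' (f x))"
  unfolding pos_cube_def pos_cube'_def pos_cube''_def by (intro continuous_intros; assumption)+

lemma norm_sq_shift_axis:
  fixes x :: "real^'n"
  shows "(norm (x + s *\<^sub>R axis i 1))\<^sup>2 = (norm x)\<^sup>2 + 2 * s * x $ i + s\<^sup>2"
proof -
  have "x \<bullet> axis i 1 = x $ i" "axis i 1 \<bullet> (axis i 1 :: real^'n) = 1"
    by (simp_all add: inner_axis inner_axis_axis)
  moreover have "(norm (x + s *\<^sub>R axis i 1))\<^sup>2
      = x \<bullet> x + 2 * s * (x \<bullet> axis i 1) + s\<^sup>2 * (axis i 1 \<bullet> (axis i 1 :: real^'n))"
    unfolding power2_norm_eq_inner
    by (simp add: inner_add_left inner_add_right inner_commute[of "axis i 1" x] power2_eq_square distrib_left)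
  ultimately show ?thesis by (simp add: power2_norm_eq_inner)
qed

text \<open>
  Every concrete function used later, mollifier or barrier, depends on space through
  \<open>p = \<bar>x\<bar>\<^sup>2\<close> only. In this variable the Laplacian is \<open>4 p G\<^sub>p\<^sub>p + 2 n G\<^sub>p\<close>.
\<close>

lemma radial_C21:
  fixes G Gp Gpp Gt :: "real \<Rightarrow> real \<Rightarrow> real"
  assumes p: "\<And>p t. ((\<lambda>p. G p t) has_real_derivative Gp p t) (at p)"
    and pp: "\<And>p t. ((\<lambda>p. Gp p t) has_real_derivative Gpp p t) (at p)"
    and t: "\<And>p t. (G p has_real_derivative Gt p t) (at t)"
    and c: "continuous_on UNIV (\<lambda>x. G (fst x) (snd x))" "continuous_on UNIV (\<lambda>x. Gp (fst x) (snd x))"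
      "continuous_on UNIV (\<lambda>x. Gpp (fst x) (snd x))" "continuous_on UNIV (\<lambda>x. Gt (fst x) (snd x))"
  shows "C21 (\<lambda>z::(real^'n) \<times> real. G ((norm (fst z))\<^sup>2) (snd z))
     (\<lambda>z. Gt ((norm (fst z))\<^sup>2) (snd z))
     (\<lambda>z. 4 * (norm (fst z))\<^sup>2 * Gpp ((norm (fst z))\<^sup>2) (snd z) + 2 * CARD('n) * Gp ((norm (fst z))\<^sup>2) (snd z))"
proof -
  have cc: "continuous_on UNIV (\<lambda>z::(real^'n) \<times> real. H ((norm (fst z))\<^sup>2) (snd z))"
    if "continuous_on UNIV (\<lambda>x. H (fst x) (snd x))" for H :: "real \<Rightarrow> real \<Rightarrow> real"
    using continuous_on_compose2[OF that, of UNIV "\<lambda>z::(real^'n) \<times> real. ((norm (fst z))\<^sup>2, snd z)"]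
    by (simp add: continuous_intros)
  note cs = c[THEN cc]
  have sq: "((\<lambda>s. (norm (x + s *\<^sub>R axis i 1))\<^sup>2) has_real_derivative 2 * x $ i) (at 0)" for x :: "real^'n" and i
    unfolding norm_sq_shift_axis by (auto intro!: derivative_eq_intros)
  have ch: "((\<lambda>s. H ((norm (x + s *\<^sub>R axis i 1))\<^sup>2) t) has_real_derivative H' ((norm x)\<^sup>2) t * (2 * x $ i)) (at 0)"
    if "\<And>p t. ((\<lambda>p. H p t) has_real_derivative H' p t) (at p)"
    for H H' :: "real \<Rightarrow> real \<Rightarrow> real" and x :: "real^'n" and i t
  proof -
    have "((\<lambda>p. H p t) has_real_derivative H' ((norm x)\<^sup>2) t) (at ((norm (x + 0 *\<^sub>R axis i 1))\<^sup>2))"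
      using that by simp
    from DERIV_chain2[OF this sq] show ?thesis .
  qed
  let ?D = "\<lambda>i z::(real^'n) \<times> real. Gp ((norm (fst z))\<^sup>2) (snd z) * (2 * fst z $ i)"
  let ?E = "\<lambda>i z::(real^'n) \<times> real. Gpp ((norm (fst z))\<^sup>2) (snd z) * (2 * fst z $ i)\<^sup>2 + 2 * Gp ((norm (fst z))\<^sup>2) (snd z)"
  have dt: "has_dir_deriv (0, 1) (\<lambda>z::(real^'n) \<times> real. G ((norm (fst z))\<^sup>2) (snd z)) (\<lambda>z. Gt ((norm (fst z))\<^sup>2) (snd z))"
    unfolding has_dir_deriv_def
  proof (intro conjI cs allI)
    fix z :: "(real^'n) \<times> real"
    show "((\<lambda>s. G ((norm (fst (z + s *\<^sub>R (0, 1))))\<^sup>2) (snd (z + s *\<^sub>R (0, 1)))) has_real_derivative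
        Gt ((norm (fst z))\<^sup>2) (snd z)) (at 0)"
      using DERIV_shift[of "G ((norm (fst z))\<^sup>2)" "Gt ((norm (fst z))\<^sup>2) (snd z)" 0 "snd z"]
        t[of "(norm (fst z))\<^sup>2" "snd z"]
      by (simp add: add.commute)
  qed
  have dx: "has_dir_deriv (axis i 1, 0) (\<lambda>z::(real^'n) \<times> real. G ((norm (fst z))\<^sup>2) (snd z)) (?D i)" for i
    unfolding has_dir_deriv_def using ch[OF p]
    by (intro conjI cs allI continuous_intros) simp
  have dxx: "has_dir_deriv (axis i 1, 0) (?D i) (?E i)" for i
    unfolding has_dir_deriv_def
  proof (intro conjI cs allI continuous_intros)
    fix z :: "(real^'n) \<times> real"
    have "((\<lambda>s. 2 * (fst z $ i + s)) has_real_derivative 2) (at 0)"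
      by (auto intro!: derivative_eq_intros)
    from DERIV_mult[OF ch[where H=Gp and H'=Gpp and x="fst z" and i=i and t="snd z", OF pp] this]
    have "((\<lambda>s. Gp ((norm (fst z + s *\<^sub>R axis i 1))\<^sup>2) (snd z) * (2 * (fst z $ i + s))) has_real_derivative ?E i z) (at 0)"
      by (simp add: power2_eq_square algebra_simps)
    then show "((\<lambda>s. ?D i (z + s *\<^sub>R (axis i 1, 0))) has_real_derivative ?E i z) (at 0)"
      by (simp add: axis_def)
  qed
  have "(\<Sum>i\<in>UNIV. ?E i z) = 4 * (norm (fst z))\<^sup>2 * Gpp ((norm (fst z))\<^sup>2) (snd z) + 2 * CARD('n) * Gp ((norm (fst z))\<^sup>2) (snd z)" for z
  proof -
    have "(norm (fst z))\<^sup>2 = (\<Sum>i\<in>UNIV. (fst z $ i)\<^sup>2)"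
      by (simp add: norm_vec_def L2_set_def sum_nonneg)
    then show ?thesis by (simp add: sum.distrib power_mult_distrib sum_distrib_left sum_distrib_right mult_ac)
  qed
  then show ?thesis unfolding C21_def
    using dt dx dxx by (intro conjI exI[of _ ?D] exI[of _ ?E]) auto
qed

text \<open>
  The kernel is \<open>pos_cube (1 - \<bar>z\<bar>\<^sup>2 / e\<^sup>2)\<close> divided by its integral, which is positive because the
  function is positive on an open ball.
\<close>

lemma mollifier_exists:
  fixes e :: real
  assumes "e > 0"
  obtains \<rho> a b :: "(real^'n) \<times> real \<Rightarrow> real" where "C21 \<rho> a b" "\<And>z. \<rho> z \<ge> 0"
    "\<And>z. norm z > e \<Longrightarrow> \<rho> z = 0" "(\<integral>z. \<rho> z \<partial>lborel) = 1"
proof -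
  let ?q = "\<lambda>p t::real. 1 - (p + t\<^sup>2) / e\<^sup>2"
  define \<sigma> :: "(real^'n) \<times> real \<Rightarrow> real" where "\<sigma> z = pos_cube (?q ((norm (fst z))\<^sup>2) (snd z))" for z
  define c where "c = (\<integral>z. \<sigma> z \<partial>lborel)"
  have n: "(norm z)\<^sup>2 = (norm (fst z))\<^sup>2 + (snd z)\<^sup>2" for z :: "(real^'n) \<times> real"
    by (cases z) (simp add: norm_Pair)
  have z0: "\<sigma> z = 0" if "norm z > e" for z
  proof -
    have "(norm z)\<^sup>2 > e\<^sup>2" using that assms by (intro power_strict_mono) auto
    then show ?thesis unfolding \<sigma>_def using assms by (intro pos_cube_simps) (simp add: n field_simps)
  qed
  have cont: "continuous_on UNIV \<sigma>" unfolding \<sigma>_def 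
    by (intro continuous_pos_cube continuous_intros) (use assms in auto)
  have int: "integrable lborel \<sigma>"
    by (rule compact_support_integrable[OF cont, of "cball 0 e"]) (use z0 in auto)
  have nn: "\<sigma> z \<ge> 0" for z by (simp add: \<sigma>_def pos_cube_simps)
  have "c \<noteq> 0"
  proof
    assume "c = 0"
    then have "AE z in lborel. \<sigma> z = 0" unfolding c_def
      using integral_nonneg_eq_0_iff_AE[OF int] nn by auto
    moreover have "z \<notin> ball (0::(real^'n) \<times> real) e" if "\<sigma> z = 0" for z
    proof
      assume "z \<in> ball 0 e"
      then have "(norm z)\<^sup>2 < e\<^sup>2" using assms by (intro power_strict_mono) auto
      then have "\<sigma> z > 0" unfolding \<sigma>_def using assms by (intro pos_cube_simps) (simp add: n field_simps)
      with that show False by simp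
    qed
    ultimately have "AE z in lborel. z \<notin> ball (0::(real^'n) \<times> real) e" by (rule eventually_mono)
    then have "emeasure lborel (ball (0::(real^'n) \<times> real) e) = 0"
      by (subst (asm) AE_iff_measurable[of "ball 0 e"]) auto
    then show False using assms by (simp add: emeasure_ball unit_ball_vol_pos less_imp_neq[symmetric]) 
  qed
  moreover have "c \<ge> 0" unfolding c_def by (simp add: nn)
  ultimately have c: "c > 0" by simp
  let ?G = "\<lambda>p t. pos_cube (?q p t) / c"
  let ?Gp = "\<lambda>p t. - pos_cube' (?q p t) / e\<^sup>2 / c"
  let ?Gpp = "\<lambda>p t. pos_cube'' (?q p t) / e\<^sup>2 / e\<^sup>2 / c"
  let ?Gt = "\<lambda>p t. pos_cube' (?q p t) * (- 2 * t / e\<^sup>2) / c"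
  have "C21 (\<lambda>z::(real^'n) \<times> real. ?G ((norm (fst z))\<^sup>2) (snd z))
     (\<lambda>z. ?Gt ((norm (fst z))\<^sup>2) (snd z))
     (\<lambda>z. 4 * (norm (fst z))\<^sup>2 * ?Gpp ((norm (fst z))\<^sup>2) (snd z) + 2 * CARD('n) * ?Gp ((norm (fst z))\<^sup>2) (snd z))"
    using assms c
    by (intro radial_C21 continuous_pos_cube continuous_intros)
       (auto intro!: derivative_eq_intros DERIV_chain2[OF pos_cube_deriv] DERIV_chain2[OF pos_cube'_deriv] simp: field_simps)
  moreover have "(\<integral>z. \<sigma> z / c \<partial>lborel) = 1" using c by (simp add: c_def[symmetric])
  ultimately show thesis
    using z0 nn c by (intro that[of "\<lambda>z. \<sigma> z / c"]) (auto simp: \<sigma>_def)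
qed

section \<open>Strong convergence of mollifications\<close>

lemma AE_lborel_not_negligible:
  assumes "negligible (N :: 'a::euclidean_space set)"
  shows "AE z in lborel. z \<notin> N"
proof -
  have "N \<in> null_sets lebesgue" using assms by (simp add: negligible_iff_null_sets)
  then have "AE z in lebesgue. z \<notin> N" by (rule AE_not_in)
  then show ?thesis by (simp add: AE_completion_iff)
qed

definition plateau :: "nat \<Rightarrow> 'a::euclidean_space \<Rightarrow> real" where
  "plateau m z = max 0 (min 1 (real m + 1 - norm z))"

definition clamp_to :: "real \<Rightarrow> real \<Rightarrow> real" where "clamp_to m y = max (- m) (min m y)"

text \<open>
  Cutting off in space and in height changes \<open>f\<close> little in \<open>L\<^sup>1\<close>. A measurable function is almost
  everywhere the limit of continuous functions; the same cutoffs applied to these are dominated, so they converge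
  in \<open>L\<^sup>1\<close> as well.
\<close>

lemma continuous_approx_L1:
  fixes f :: "'a::euclidean_space \<Rightarrow> real"
  assumes f: "integrable lborel f" and "\<eta> > 0"
  obtains g K where "continuous_on UNIV g" "compact K" "\<And>z. z \<notin> K \<Longrightarrow> g z = 0"
    "(\<integral>z. \<bar>g z - f z\<bar> \<partial>lborel) < \<eta>"
proof -
  note [measurable] = f
  have [measurable]: "plateau m \<in> borel_measurable borel" for m
    unfolding plateau_def[abs_def] by measurable
  have [measurable]: "clamp_to m \<in> borel_measurable borel" for m
    unfolding clamp_to_def[abs_def] by measurable
  have pl: "0 \<le> plateau m z" "plateau m z \<le> 1" "norm z > real m + 1 \<Longrightarrow> plateau m z = 0" for m and z :: 'a
    by (auto simp: plateau_def)
  define h where "h m z = plateau m z * clamp_to (real m) (f z)" for m :: nat and z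
  have hm[measurable]: "h m \<in> borel_measurable borel" for m unfolding h_def by measurable
  have hle: "\<bar>h m z\<bar> \<le> \<bar>f z\<bar>" for m z
  proof -
    have "\<bar>clamp_to (real m) (f z)\<bar> \<le> \<bar>f z\<bar>" by (auto simp: clamp_to_def)
    then show ?thesis unfolding h_def abs_mult
      using mult_mono[of "\<bar>plateau m z\<bar>" 1 "\<bar>clamp_to (real m) (f z)\<bar>" "\<bar>f z\<bar>"] pl[of m z] by simp
  qed
  have "(\<lambda>m. \<integral>z. \<bar>h m z - f z\<bar> \<partial>lborel) \<longlonglongrightarrow> (\<integral>z. 0 \<partial>(lborel :: 'a measure))"
  proof (rule integral_dominated_convergence[where w="\<lambda>z. 2 * \<bar>f z\<bar>"])
    show "AE z in lborel. norm \<bar>h m z - f z\<bar> \<le> 2 * \<bar>f z\<bar>" for m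
    proof (rule AE_I2)
      show "norm \<bar>h m z - f z\<bar> \<le> 2 * \<bar>f z\<bar>" for z using hle[of m z] by (auto simp: abs_le_iff)
    qed
    show "AE z in lborel. (\<lambda>m. \<bar>h m z - f z\<bar>) \<longlonglongrightarrow> 0"
    proof (intro AE_I2 tendsto_eventually)
      fix z
      obtain M :: nat where M: "norm z + \<bar>f z\<bar> \<le> real M" using real_arch_simple by blast
      show "\<forall>\<^sub>F m in sequentially. \<bar>h m z - f z\<bar> = 0"
        unfolding eventually_sequentially
      proof (intro exI allI impI)
        fix m assume "M \<le> m"
        then have "norm z + \<bar>f z\<bar> \<le> real m" using M by linarith
        then have "norm z \<le> real m" "\<bar>f z\<bar> \<le> real m" by (smt (verit) norm_ge_zero)+
        then have "plateau m z = 1" "clamp_to (real m) (f z) = f z" by (auto simp: plateau_def clamp_to_def)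
        then show "\<bar>h m z - f z\<bar> = 0" by (simp add: h_def)
      qed
    qed
  qed (use f in auto)
  then have "\<forall>\<^sub>F m in sequentially. (\<integral>z. \<bar>h m z - f z\<bar> \<partial>lborel) < \<eta> / 2"
    using \<open>\<eta> > 0\<close> by (intro order_tendstoD) auto
  then obtain m where m: "(\<integral>z. \<bar>h m z - f z\<bar> \<partial>lborel) < \<eta> / 2"
    using eventually_happens'[OF sequentially_bot] by blast
  have "f \<in> borel_measurable lebesgue" using f by (intro measurable_completion) auto
  then have "f measurable_on UNIV" by (rule lebesgue_measurable_imp_measurable_on) auto
  then obtain N g where N: "negligible N" and cg: "\<And>n. continuous_on UNIV (g n)"
    and lim: "\<And>z. z \<notin> N \<Longrightarrow> (\<lambda>n::nat. g n z) \<longlonglongrightarrow> f z"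
    unfolding measurable_on_def by auto
  define G where "G n z = plateau m z * clamp_to (real m) (g n z)" for n z
  have cG: "continuous_on UNIV (G n)" for n
    unfolding G_def plateau_def clamp_to_def by (intro continuous_intros cg)
  have G0: "G n z = 0" "h m z = 0" if "z \<notin> cball 0 (real m + 1)" for n z
    using that pl by (auto simp: G_def h_def)
  note [measurable] = borel_measurable_continuous_onI[OF cG]
  have "(\<lambda>n. \<integral>z. \<bar>G n z - h m z\<bar> \<partial>lborel) \<longlonglongrightarrow> (\<integral>z. 0 \<partial>(lborel :: 'a measure))"
  proof (rule integral_dominated_convergence[where w="\<lambda>z. 2 * real m * indicator (cball 0 (real m + 1)) z"])
    show "AE z in lborel. norm \<bar>G n z - h m z\<bar> \<le> 2 * real m * indicator (cball 0 (real m + 1)) z" for n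
    proof (rule AE_I2)
      fix z :: 'a
      have "\<bar>plateau m z * clamp_to (real m) y\<bar> \<le> real m" for y
        unfolding abs_mult using pl[of m z]
        mult_mono[of "\<bar>plateau m z\<bar>" 1 "\<bar>clamp_to (real m) y\<bar>" "real m"] by (auto simp: clamp_to_def)
      then have "\<bar>G n z\<bar> \<le> real m" "\<bar>h m z\<bar> \<le> real m" unfolding G_def h_def by auto
      then have "\<bar>G n z - h m z\<bar> \<le> 2 * real m" by linarith
      then show "norm \<bar>G n z - h m z\<bar> \<le> 2 * real m * indicator (cball 0 (real m + 1)) z"
        using G0(1)[of z n] G0(2)[of z] by (cases "z \<in> cball 0 (real m + 1)") auto
    qed
    show "AE z in lborel. (\<lambda>n. \<bar>G n z - h m z\<bar>) \<longlonglongrightarrow> 0"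
      using AE_lborel_not_negligible[OF N]
    proof (rule eventually_mono)
      fix z assume "z \<notin> N"
      then have "(\<lambda>n. \<bar>G n z - h m z\<bar>) \<longlonglongrightarrow> \<bar>plateau m z * clamp_to (real m) (f z) - h m z\<bar>"
        unfolding G_def clamp_to_def by (intro tendsto_intros lim)
      then show "(\<lambda>n. \<bar>G n z - h m z\<bar>) \<longlonglongrightarrow> 0" by (simp add: h_def)
    qed
  qed auto
  then have "\<forall>\<^sub>F n in sequentially. (\<integral>z. \<bar>G n z - h m z\<bar> \<partial>lborel) < \<eta> / 2"
    using \<open>\<eta> > 0\<close> by (intro order_tendstoD) auto
  then obtain n where n: "(\<integral>z. \<bar>G n z - h m z\<bar> \<partial>lborel) < \<eta> / 2"
    using eventually_happens'[OF sequentially_bot] by blast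
  have iG: "integrable lborel (G n)"
    by (rule compact_support_integrable[OF cG compact_cball G0(1)])
  have ih: "integrable lborel (h m)"
    by (rule Bochner_Integration.integrable_bound[OF f]) (use hle in auto)
  have "(\<integral>z. \<bar>G n z - f z\<bar> \<partial>lborel) \<le> (\<integral>z. \<bar>G n z - h m z\<bar> + \<bar>h m z - f z\<bar> \<partial>lborel)"
    by (rule integral_mono) (use iG ih f in auto)
  also have "\<dots> < \<eta>" using m n iG ih f by (subst Bochner_Integration.integral_add) auto
  finally have "(\<integral>z. \<bar>G n z - f z\<bar> \<partial>lborel) < \<eta>" .
  then show thesis
    using that[OF cG[of n] compact_cball[of 0 "real m + 1"]] G0(1)[of _ n] by metis
qed

lemma translation_continuous_compact_support:
  fixes g :: "'a::euclidean_space \<Rightarrow> real"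
  assumes c: "continuous_on UNIV g" and K: "compact K" "\<And>z. z \<notin> K \<Longrightarrow> g z = 0"
  shows "((\<lambda>h. \<integral>z. \<bar>g (z + h) - g z\<bar> \<partial>lborel) \<longlongrightarrow> 0) (at 0)"
proof -
  obtain B where B: "B > 0" "\<And>z. \<bar>g z\<bar> \<le> B" using compact_support_bounded[OF c K] by blast
  obtain R where R: "\<And>z. z \<in> K \<Longrightarrow> norm z \<le> R"
    using compact_imp_bounded[OF K(1)] by (auto simp: bounded_iff)
  note [measurable] = borel_measurable_continuous_onI[OF c]
  have "(\<lambda>n. \<integral>z. \<bar>g (z + X n) - g z\<bar> \<partial>lborel) \<longlonglongrightarrow> 0" if X: "X \<longlonglongrightarrow> 0" for X :: "nat \<Rightarrow> 'a"
  proof -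
    obtain M where M: "\<And>n. norm (X n) \<le> M"
      using Bseq_def convergent_imp_Bseq[of X] X by (auto simp: convergent_def Bseq_def)
    have "(\<lambda>n. \<integral>z. \<bar>g (z + X n) - g z\<bar> \<partial>lborel) \<longlonglongrightarrow> (\<integral>z. 0 \<partial>(lborel :: 'a measure))"
    proof (rule integral_dominated_convergence[where w="\<lambda>z. 2 * B * indicator (cball 0 (R + M)) z"])
      show "AE z in lborel. (\<lambda>n. \<bar>g (z + X n) - g z\<bar>) \<longlonglongrightarrow> 0"
      proof (rule AE_I2)
        fix z
        have "isCont g z" using c by (simp add: continuous_on_eq_continuous_at)
        moreover have "(\<lambda>n. z + X n) \<longlonglongrightarrow> z" using tendsto_add[OF tendsto_const X, of z] by simp
        ultimately have "(\<lambda>n. g (z + X n)) \<longlonglongrightarrow> g z" by (rule isCont_tendsto_compose)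
        from tendsto_rabs[OF tendsto_diff[OF this tendsto_const, of "g z"]]
        show "(\<lambda>n. \<bar>g (z + X n) - g z\<bar>) \<longlonglongrightarrow> 0" by simp
      qed
      show "AE z in lborel. norm \<bar>g (z + X n) - g z\<bar> \<le> 2 * B * indicator (cball 0 (R + M)) z" for n
      proof (rule AE_I2)
        fix z
        show "norm \<bar>g (z + X n) - g z\<bar> \<le> 2 * B * indicator (cball 0 (R + M)) z"
        proof (cases "norm z \<le> R + M")
          case True
          then show ?thesis using B(2)[of z] B(2)[of "z + X n"] by (auto simp: abs_le_iff)
        next
          case False
          have "norm z \<le> norm (z + X n) + norm (X n)" using norm_triangle_ineq4[of "z + X n" "X n"] by simp
          then have "z + X n \<notin> K" using R[of "z + X n"] M[of n] False by linarith
          moreover have "z \<notin> K" using R[of z] M[of n] False norm_ge_zero[of "X n"] by linarith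
          ultimately show ?thesis using K(2) False by simp
        qed
      qed
    qed auto
    then show ?thesis by simp
  qed
  then show ?thesis unfolding tendsto_at_iff_sequentially comp_def by blast
qed

text \<open>
  For a continuous function with compact support this is dominated convergence. In general, compare \<open>f\<close>
  with such a function; the error does not change under translation.
\<close>

lemma translation_continuous_L1:
  fixes f :: "'a::euclidean_space \<Rightarrow> real"
  assumes f: "integrable lborel f" and "\<eta> > 0"
  obtains d where "d > 0" "\<And>h. norm h \<le> d \<Longrightarrow> (\<integral>z. \<bar>f (z + h) - f z\<bar> \<partial>lborel) \<le> \<eta>"
proof -
  obtain g K where g: "continuous_on UNIV g" "compact K" "\<And>z. z \<notin> K \<Longrightarrow> g z = 0"
    and fg: "(\<integral>z. \<bar>g z - f z\<bar> \<partial>lborel) < \<eta> / 4"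
    using continuous_approx_L1[OF f, of "\<eta> / 4"] \<open>\<eta> > 0\<close> by auto
  note gi = compact_support_integrable[OF g]
  note [measurable] = f gi
  have "\<forall>\<^sub>F h in at 0. (\<integral>z. \<bar>g (z + h) - g z\<bar> \<partial>lborel) < \<eta> / 2"
    using translation_continuous_compact_support[OF g] \<open>\<eta> > 0\<close> by (intro order_tendstoD) auto
  then obtain d where d: "d > 0" "\<And>h. h \<noteq> 0 \<Longrightarrow> dist h 0 < d \<Longrightarrow> (\<integral>z. \<bar>g (z + h) - g z\<bar> \<partial>lborel) < \<eta> / 2"
    unfolding eventually_at by auto
  show thesis
  proof (rule that[of "d / 2"])
    fix h :: 'a assume "norm h \<le> d / 2"
    then have gh: "(\<integral>z. \<bar>g (z + h) - g z\<bar> \<partial>lborel) \<le> \<eta> / 2"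
      using d(2)[of h] \<open>d > 0\<close> \<open>\<eta> > 0\<close> by (cases "h = 0") auto
    note fh = lborel_integrable_shift[OF f, of h] and gih = lborel_integrable_shift[OF gi, of h]
    have gfi: "integrable lborel (\<lambda>z. \<bar>g z - f z\<bar>)" using f gi by auto
    have "(\<integral>z. \<bar>f (z + h) - f z\<bar> \<partial>lborel)
        \<le> (\<integral>z. \<bar>g (z + h) - f (z + h)\<bar> + \<bar>g (z + h) - g z\<bar> + \<bar>g z - f z\<bar> \<partial>lborel)"
      by (rule integral_mono) (use f gi fh gih in auto)
    also have "\<dots> = (\<integral>z. \<bar>g (z + h) - f (z + h)\<bar> \<partial>lborel) + (\<integral>z. \<bar>g (z + h) - g z\<bar> \<partial>lborel) + (\<integral>z. \<bar>g z - f z\<bar> \<partial>lborel)"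
      using f gi fh gih by simp
    also have "(\<integral>z. \<bar>g (z + h) - f (z + h)\<bar> \<partial>lborel) = (\<integral>z. \<bar>g z - f z\<bar> \<partial>lborel)"
      using lborel_integral_shift[of "\<lambda>z. \<bar>g z - f z\<bar>" h] by simp
    also have "(\<integral>z. \<bar>g z - f z\<bar> \<partial>lborel) + (\<integral>z. \<bar>g (z + h) - g z\<bar> \<partial>lborel) + (\<integral>z. \<bar>g z - f z\<bar> \<partial>lborel) \<le> \<eta>"
      using fg gh by linarith
    finally show "(\<integral>z. \<bar>f (z + h) - f z\<bar> \<partial>lborel) \<le> \<eta>" .
  qed (use \<open>d > 0\<close> in auto)
qed

lemma lborel_reflect: "distr lborel borel (\<lambda>y. z - y) = (lborel :: 'a::euclidean_space measure)"
  using lborel_affine[of "-1" z] by (simp add: density_1)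

text \<open>
  As the kernel has mass one, \<open>convolution f \<rho> z - f z\<close> is the \<open>\<rho>\<close>-average over \<open>h\<close> of
  \<open>f (z - h) - f z\<close>. Tonelli's theorem bounds its \<open>L\<^sup>1\<close> norm by the average of the norms of these
  translation differences.
\<close>

lemma convolution_minus_le:
  fixes f \<rho> :: "'a::euclidean_space \<Rightarrow> real"
  assumes f: "integrable lborel f" and \<rho>: "continuous_on UNIV \<rho>" "compact K" "\<And>z. z \<notin> K \<Longrightarrow> \<rho> z = 0"
     "\<And>z. \<rho> z \<ge> 0" "(\<integral>z. \<rho> z \<partial>lborel) = 1"
    and small: "\<And>h. \<rho> h \<noteq> 0 \<Longrightarrow> (\<integral>z. \<bar>f (z - h) - f z\<bar> \<partial>lborel) \<le> \<eta>" and \<eta>: "\<eta> \<ge> 0"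
  shows "(\<integral>\<^sup>+z. norm (convolution f \<rho> z - f z) \<partial>lborel) \<le> ennreal \<eta>"
proof -
  have \<rho>i: "integrable lborel \<rho>" using compact_support_integrable[OF \<rho>(1-3)] .
  obtain B where B: "\<And>z. \<bar>\<rho> z\<bar> \<le> B" using compact_support_bounded[OF \<rho>(1-3)] by blast
  note [measurable] = f borel_measurable_continuous_onI[OF \<rho>(1)]
  have refl: "integrable lborel (\<lambda>y. \<rho> (z - y))" "(\<integral>y. \<rho> (z - y) \<partial>lborel) = 1" for z
  proof -
    have "integrable (distr lborel borel (\<lambda>y. z - y)) \<rho>"
      unfolding lborel_reflect by (rule \<rho>i)
    then show "integrable lborel (\<lambda>y. \<rho> (z - y))" by (rule integrable_distr[rotated]) auto
    have "(\<integral>y. \<rho> (z - y) \<partial>lborel) = (\<integral>y. \<rho> y \<partial>distr lborel borel (\<lambda>y. z - y))"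
      by (subst integral_distr) auto
    then show "(\<integral>y. \<rho> (z - y) \<partial>lborel) = 1" using \<rho>(5) by (simp add: lborel_reflect)
  qed
  have "(\<integral>\<^sup>+z. norm (convolution f \<rho> z - f z) \<partial>lborel)
      \<le> (\<integral>\<^sup>+z. (\<integral>\<^sup>+h. ennreal (\<bar>f (z - h) - f z\<bar> * \<rho> h) \<partial>lborel) \<partial>lborel)"
  proof (rule nn_integral_mono)
    fix z
    have 1: "integrable lborel (\<lambda>y. f y * \<rho> (z - y))" by (rule convolution_integrable[OF f \<rho>(1) B])
    have "convolution f \<rho> z - f z = (\<integral>y. f y * \<rho> (z - y) - f z * \<rho> (z - y) \<partial>lborel)"
      using 1 refl[of z] by (simp add: convolution_def)
    also have "norm \<dots> \<le> (\<integral>y. norm (f y * \<rho> (z - y) - f z * \<rho> (z - y)) \<partial>lborel)" by simp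
    finally have "ennreal (norm (convolution f \<rho> z - f z)) \<le> ennreal (\<integral>y. norm (f y * \<rho> (z - y) - f z * \<rho> (z - y)) \<partial>lborel)"
      by (rule ennreal_leI)
    also have "\<dots> = (\<integral>\<^sup>+y. ennreal (norm (f y * \<rho> (z - y) - f z * \<rho> (z - y))) \<partial>lborel)"
      by (rule nn_integral_eq_integral[symmetric]) (use 1 refl(1)[of z] in auto)
    also have "\<dots> = (\<integral>\<^sup>+y. ennreal (\<bar>f y - f z\<bar> * \<rho> (z - y)) \<partial>lborel)"
    proof (rule nn_integral_cong)
      fix y
      have "norm (f y * \<rho> (z - y) - f z * \<rho> (z - y)) = \<bar>(f y - f z) * \<rho> (z - y)\<bar>"
        by (simp add: left_diff_distrib)
      then show "ennreal (norm (f y * \<rho> (z - y) - f z * \<rho> (z - y))) = ennreal (\<bar>f y - f z\<bar> * \<rho> (z - y))"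
        using \<rho>(4)[of "z - y"] by (simp add: abs_mult)
    qed
    also have "\<dots> = (\<integral>\<^sup>+y. ennreal (\<bar>f y - f z\<bar> * \<rho> (z - y)) \<partial>distr lborel borel (\<lambda>y. z - y))"
      by (simp add: lborel_reflect)
    also have "\<dots> = (\<integral>\<^sup>+h. ennreal (\<bar>f (z - h) - f z\<bar> * \<rho> h) \<partial>lborel)"
      by (subst nn_integral_distr) auto
    finally show "ennreal (norm (convolution f \<rho> z - f z)) \<le> (\<integral>\<^sup>+h. ennreal (\<bar>f (z - h) - f z\<bar> * \<rho> h) \<partial>lborel)" .
  qed
  also have "\<dots> = (\<integral>\<^sup>+h. (\<integral>\<^sup>+z. ennreal (\<bar>f (z - h) - f z\<bar> * \<rho> h) \<partial>lborel) \<partial>lborel)"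
    by (rule lborel_pair.Fubini'[symmetric]) simp
  also have "\<dots> \<le> (\<integral>\<^sup>+h. ennreal (\<eta> * \<rho> h) \<partial>lborel)"
  proof (rule nn_integral_mono)
    fix h
    have sh: "integrable lborel (\<lambda>z. f (z - h))" using lborel_integrable_shift[OF f, of "- h"] by simp
    have "(\<integral>\<^sup>+z. ennreal (\<bar>f (z - h) - f z\<bar> * \<rho> h) \<partial>lborel) = ennreal (\<integral>z. \<bar>f (z - h) - f z\<bar> * \<rho> h \<partial>lborel)"
      by (rule nn_integral_eq_integral) (use f sh \<rho>(4) in auto)
    also have "(\<integral>z. \<bar>f (z - h) - f z\<bar> * \<rho> h \<partial>lborel) = (\<integral>z. \<bar>f (z - h) - f z\<bar> \<partial>lborel) * \<rho> h" by simp
    also have "\<dots> \<le> \<eta> * \<rho> h"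
      using small[of h] \<rho>(4)[of h] by (cases "\<rho> h = 0") (auto intro: mult_right_mono)
    finally show "(\<integral>\<^sup>+z. ennreal (\<bar>f (z - h) - f z\<bar> * \<rho> h) \<partial>lborel) \<le> ennreal (\<eta> * \<rho> h)" by (simp add: ennreal_leI)
  qed
  also have "\<dots> = ennreal (\<integral>h. \<eta> * \<rho> h \<partial>lborel)"
    by (rule nn_integral_eq_integral) (use \<rho>i \<rho>(4) \<eta> in auto)
  also have "(\<integral>h. \<eta> * \<rho> h \<partial>lborel) = \<eta>" using \<rho>(5) by simp
  finally show ?thesis .
qed

lemma mollification_tendsto_L1:
  fixes f :: "'a::euclidean_space \<Rightarrow> real" and \<rho> :: "nat \<Rightarrow> 'a \<Rightarrow> real"
  assumes f: "integrable lborel f" and \<rho>: "\<And>k. continuous_on UNIV (\<rho> k)"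
     "\<And>k z. norm z > e k \<Longrightarrow> \<rho> k z = 0" "\<And>k z. \<rho> k z \<ge> 0" "\<And>k. (\<integral>z. \<rho> k z \<partial>lborel) = 1"
    and e: "e \<longlonglongrightarrow> 0"
  shows "\<And>k. integrable lborel (convolution f (\<rho> k))"
    and "(\<lambda>k. \<integral>z. norm (convolution f (\<rho> k) z - f z) \<partial>lborel) \<longlonglongrightarrow> 0"
proof -
  note [measurable] = f
  have z0: "\<rho> k z = 0" if "z \<notin> cball 0 (e k)" for k z using that \<rho>(2) by auto
  have bd: "\<exists>B. \<forall>z. \<bar>\<rho> k z\<bar> \<le> B" for k using compact_support_bounded[OF \<rho>(1) compact_cball z0] by metis
  have cm[measurable]: "convolution f (\<rho> k) \<in> borel_measurable borel" for k
    using continuous_convolution[OF f \<rho>(1)] bd by (metis borel_measurable_continuous_onI)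
  have nrm: "(\<integral>z. \<bar>f (z - h) - f z\<bar> \<partial>lborel) \<le> (\<integral>z. \<bar>f z\<bar> \<partial>lborel) + (\<integral>z. \<bar>f z\<bar> \<partial>lborel)" for h
  proof -
    have sh: "integrable lborel (\<lambda>z. f (z - h))" using lborel_integrable_shift[OF f, of "- h"] by simp
    have "(\<integral>z. \<bar>f (z - h) - f z\<bar> \<partial>lborel) \<le> (\<integral>z. \<bar>f (z - h)\<bar> + \<bar>f z\<bar> \<partial>lborel)"
      by (rule integral_mono) (use f sh in auto)
    also have "\<dots> = (\<integral>z. \<bar>f (z - h)\<bar> \<partial>lborel) + (\<integral>z. \<bar>f z\<bar> \<partial>lborel)" using f sh by simp
    also have "(\<integral>z. \<bar>f (z - h)\<bar> \<partial>lborel) = (\<integral>z. \<bar>f z\<bar> \<partial>lborel)"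
      using lborel_integral_shift[of "\<lambda>z. \<bar>f z\<bar>" "- h"] by simp
    finally show ?thesis .
  qed
  show ci: "integrable lborel (convolution f (\<rho> k))" for k
  proof -
    have "(\<integral>\<^sup>+z. norm (convolution f (\<rho> k) z - f z) \<partial>lborel) < \<infinity>"
      by (rule le_less_trans[OF convolution_minus_le[OF f \<rho>(1) compact_cball[of 0 "e k"] z0 \<rho>(3,4) nrm]]) auto
    then have "integrable lborel (\<lambda>z. convolution f (\<rho> k) z - f z)" by (intro integrableI_bounded) auto
    from Bochner_Integration.integrable_add[OF this f] show ?thesis by simp
  qed
  show "(\<lambda>k. \<integral>z. norm (convolution f (\<rho> k) z - f z) \<partial>lborel) \<longlonglongrightarrow> 0"
  proof (rule LIMSEQ_I)
    fix r :: real assume "r > 0"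
    obtain d where d: "d > 0" "\<And>h. norm h \<le> d \<Longrightarrow> (\<integral>z. \<bar>f (z + h) - f z\<bar> \<partial>lborel) \<le> r / 2"
      using translation_continuous_L1[OF f, of "r / 2"] \<open>r > 0\<close> by auto
    obtain n where n: "\<And>k. k \<ge> n \<Longrightarrow> norm (e k - 0) < d" using LIMSEQ_D[OF e d(1)] by blast
    show "\<exists>no. \<forall>k\<ge>no. norm ((\<integral>z. norm (convolution f (\<rho> k) z - f z) \<partial>lborel) - 0) < r"
    proof (intro exI allI impI)
      fix k assume "k \<ge> n"
      have "(\<integral>z. \<bar>f (z - h) - f z\<bar> \<partial>lborel) \<le> r / 2" if "\<rho> k h \<noteq> 0" for h
      proof -
        have "norm h \<le> d" using that \<rho>(2)[where k=k and z=h] n[OF \<open>k \<ge> n\<close>] by force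
        then show ?thesis using d(2)[of "- h"] by simp
      qed
      from convolution_minus_le[OF f \<rho>(1) compact_cball[of 0 "e k"] z0 \<rho>(3,4) this]
      have "(\<integral>\<^sup>+z. norm (convolution f (\<rho> k) z - f z) \<partial>lborel) \<le> ennreal (r / 2)" using \<open>r > 0\<close> by simp
      moreover have "(\<integral>\<^sup>+z. norm (convolution f (\<rho> k) z - f z) \<partial>lborel) = ennreal (\<integral>z. norm (convolution f (\<rho> k) z - f z) \<partial>lborel)"
        by (rule nn_integral_eq_integral) (use ci f in auto)
      ultimately have "(\<integral>z. norm (convolution f (\<rho> k) z - f z) \<partial>lborel) \<le> r / 2"
        using \<open>r > 0\<close> by (simp add: ennreal_le_iff)
      then show "norm ((\<integral>z. norm (convolution f (\<rho> k) z - f z) \<partial>lborel) - 0) < r"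
        using \<open>r > 0\<close> by (simp del: real_norm_def add: real_norm_def[of "integral\<^sup>L _ _"])
    qed
  qed
qed

section \<open>Kato's inequality\<close>

text \<open>
  Here \<open>U\<close> solves \<open>\<partial>\<^sub>t U - \<Delta> U = - F\<close> in the sense of distributions for times below \<open>T\<close>,
  and \<open>F\<close> has the sign of \<open>U\<close>. Mollify \<open>U\<close> and \<open>F\<close>, use the pointwise inequality
  \<open>smooth_abs_subsolution\<close> for the mollified solution, remove first the mollification and then the
  regularisation of the absolute value. The right-hand side converges because \<open>smooth_sgn d\<close> is bounded and
  continuous and the mollified solutions converge almost everywhere along a subsequence.
\<close>

theorem kato_inequality:
  fixes U F :: "(real^'n) \<times> real \<Rightarrow> real"
  assumes U: "U \<in> borel_measurable borel" "\<And>R. integrable lborel (\<lambda>z. indicator (cball 0 R) z * U z)"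
    and F: "F \<in> borel_measurable borel" "\<And>R. integrable lborel (\<lambda>z. indicator (cball 0 R) z * F z)"
    and eq: "\<And>\<phi> a b R \<tau>. C21 \<phi> a b \<Longrightarrow> \<tau> < T \<Longrightarrow> (\<And>z. norm z > R \<or> snd z > \<tau> \<Longrightarrow> \<phi> z = 0) \<Longrightarrow>
        (\<integral>z. U z * (a z + b z) \<partial>lborel) = (\<integral>z. F z * \<phi> z \<partial>lborel)"
    and sign: "AE z in lborel. U z * F z \<ge> 0"
    and \<phi>: "C21 \<phi> a b" "\<And>z. \<phi> z \<ge> 0" "\<tau> < T" "\<And>z. norm z > R \<or> snd z > \<tau> \<Longrightarrow> \<phi> z = 0"
  shows "(\<integral>z. \<bar>U z\<bar> * (a z + b z) \<partial>lborel) \<ge> 0"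
proof -
  \<comment> \<open>Near the support of the test function only the values of \<open>U\<close> and \<open>F\<close> on a ball matter; truncated there, both are integrable.\<close>
  define U1 where "U1 z = indicator (cball 0 (R + 1)) z * U z" for z
  define F1 where "F1 z = indicator (cball 0 (R + 1)) z * F z" for z
  have U1: "integrable lborel U1" and F1: "integrable lborel F1"
    unfolding U1_def F1_def by (fact U(2), fact F(2))
  note [measurable] = U(1) F(1) U1 F1
  note ca = C21_continuous[OF \<phi>(1)]
  define L where "L z = a z + b z" for z
  have cL: "continuous_on UNIV L" unfolding L_def by (intro continuous_intros ca)
  have \<phi>0: "\<phi> z = 0" if "z \<notin> cball 0 R" for z using that by (intro \<phi>(4)) auto
  have L0: "L z = 0" if "z \<notin> cball 0 R" for z
    using C21_eq_0_off_support[OF \<phi>(1) closed_cball \<phi>0 that] by (simp add: L_def)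
  obtain BL where BL: "BL > 0" "\<And>z. \<bar>L z\<bar> \<le> BL" using compact_support_bounded[OF cL compact_cball L0] by blast
  obtain BP where BP: "BP > 0" "\<And>z. \<bar>\<phi> z\<bar> \<le> BP" using compact_support_bounded[OF ca(1) compact_cball \<phi>0] by blast
  have iL: "integrable lborel L" by (rule compact_support_integrable[OF cL compact_cball L0])
  note [measurable] = borel_measurable_continuous_onI[OF cL] borel_measurable_continuous_onI[OF ca(1)]
  \<comment> \<open>The radii are so small that kernels centred in the support of the test function reach neither past the truncation ball nor up to time \<open>T\<close>.\<close>
  define e where "e k = min 1 ((T - \<tau>) / 2) / real (Suc k)" for k
  have e: "e k > 0" "e k \<le> 1" "\<tau> + e k < T" for k
  proof -
    have p: "min 1 ((T - \<tau>) / 2) > 0" using \<phi>(3) by simp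
    then show "e k > 0" unfolding e_def by simp
    have "e k \<le> min 1 ((T - \<tau>) / 2)" unfolding e_def using p by (subst pos_divide_le_eq) auto
    then show "e k \<le> 1" "\<tau> + e k < T" using \<phi>(3) by (auto simp: field_simps)
  qed
  have e_lim: "e \<longlonglongrightarrow> 0"
  proof -
    define m where "m = min 1 ((T - \<tau>) / 2)"
    have "(\<lambda>k. m * inverse (real (Suc k))) \<longlonglongrightarrow> m * 0"
      by (intro tendsto_mult tendsto_const LIMSEQ_inverse_real_of_nat)
    then show ?thesis unfolding e_def m_def[symmetric] by (simp add: divide_inverse)
  qed
  have ex: "\<forall>k. \<exists>\<rho> p q. C21 \<rho> p q \<and> (\<forall>z::(real^'n) \<times> real. \<rho> z \<ge> 0) \<and> (\<forall>z. norm z > e k \<longrightarrow> \<rho> z = 0) \<and> (\<integral>z. \<rho> z \<partial>lborel) = 1"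
  proof
    fix k
    obtain \<rho> p q where "C21 \<rho> p q" "\<And>z::(real^'n) \<times> real. \<rho> z \<ge> 0" "\<And>z. norm z > e k \<Longrightarrow> \<rho> z = 0" "(\<integral>z. \<rho> z \<partial>lborel) = 1"
      using mollifier_exists[OF e(1)[of k]] by blast
    then show "\<exists>\<rho> p q. C21 \<rho> p q \<and> (\<forall>z::(real^'n) \<times> real. \<rho> z \<ge> 0) \<and> (\<forall>z. norm z > e k \<longrightarrow> \<rho> z = 0) \<and> (\<integral>z. \<rho> z \<partial>lborel) = 1"
      by blast
  qed
  from choice[OF ex] obtain \<rho> where "\<forall>k. \<exists>p q. C21 (\<rho> k) p q \<and> (\<forall>z::(real^'n) \<times> real. \<rho> k z \<ge> 0) \<and> (\<forall>z. norm z > e k \<longrightarrow> \<rho> k z = 0) \<and> (\<integral>z. \<rho> k z \<partial>lborel) = 1" ..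
  from choice[OF this] obtain p where "\<forall>k. \<exists>q. C21 (\<rho> k) (p k) q \<and> (\<forall>z::(real^'n) \<times> real. \<rho> k z \<ge> 0) \<and> (\<forall>z. norm z > e k \<longrightarrow> \<rho> k z = 0) \<and> (\<integral>z. \<rho> k z \<partial>lborel) = 1" ..
  from choice[OF this] obtain q where \<rho>': "\<forall>k. C21 (\<rho> k) (p k) (q k) \<and> (\<forall>z::(real^'n) \<times> real. \<rho> k z \<ge> 0) \<and> (\<forall>z. norm z > e k \<longrightarrow> \<rho> k z = 0) \<and> (\<integral>z. \<rho> k z \<partial>lborel) = 1" ..
  have \<rho>: "\<And>k. C21 (\<rho> k) (p k) (q k)" "\<And>k z::(real^'n) \<times> real. \<rho> k z \<ge> 0"
     "\<And>k z. norm z > e k \<Longrightarrow> \<rho> k z = 0" "\<And>k. (\<integral>z. \<rho> k z \<partial>lborel) = 1" using \<rho>' by blast+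
  note c\<rho> = C21_continuous[OF \<rho>(1)]
  have \<rho>0: "\<rho> k z = 0" "p k z = 0" "q k z = 0" if "z \<notin> cball 0 (e k)" for k z
  proof -
    have 1: "\<rho> k z = 0" if "z \<notin> cball 0 (e k)" for z using that by (intro \<rho>(3)) auto
    show "\<rho> k z = 0" using 1 that .
    show "p k z = 0" "q k z = 0" using C21_eq_0_off_support[OF \<rho>(1) closed_cball 1 that] by auto
  qed
  define w where "w k = convolution U1 (\<rho> k)" for k
  define f where "f k = convolution F1 (\<rho> k)" for k
  have w: "C21 (w k) (convolution U1 (p k)) (convolution U1 (q k))" for k
    unfolding w_def by (rule convolution_C21[OF U1 \<rho>(1) compact_cball \<rho>0(1)])
  have wi: "integrable lborel (w k)" and wlim: "(\<lambda>k. \<integral>z. norm (w k z - U1 z) \<partial>lborel) \<longlonglongrightarrow> 0"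
    and fi: "integrable lborel (f k)" and flim: "(\<lambda>k. \<integral>z. norm (f k z - F1 z) \<partial>lborel) \<longlonglongrightarrow> 0" for k
    unfolding w_def f_def
    by (rule mollification_tendsto_L1[OF U1 c\<rho>(1) \<rho>(3,2,4) e_lim] mollification_tendsto_L1[OF F1 c\<rho>(1) \<rho>(3,2,4) e_lim]; assumption)+
  have cf: "continuous_on UNIV (f k)" for k
  proof -
    obtain B where "\<And>z. \<bar>\<rho> k z\<bar> \<le> B" using compact_support_bounded[OF c\<rho>(1) compact_cball \<rho>0(1)] by blast
    then show ?thesis unfolding f_def by (rule continuous_convolution[OF F1 c\<rho>(1)])
  qed
  note cw = C21_continuous[OF w]
  note [measurable] = wi fi borel_measurable_continuous_onI[OF cw(1)] borel_measurable_continuous_onI[OF cf]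
  have pde: "- convolution U1 (p k) z + convolution U1 (q k) z = f k z" if z: "norm z \<le> R" "snd z \<le> \<tau>" for k z
  proof -
    have far: "z - y \<notin> cball 0 (e k)" if "norm y > R + 1 \<or> snd y > \<tau> + e k" for y
    proof
      assume "z - y \<in> cball 0 (e k)"
      then have n: "norm (z - y) \<le> e k" by simp
      have "norm y \<le> norm z + norm (z - y)" using norm_triangle_ineq4[of z "z - y"] by simp
      moreover have "norm (snd (z - y)) \<le> norm (z - y)" by (metis norm_snd_le prod.collapse)
      then have "\<bar>snd z - snd y\<bar> \<le> norm (z - y)" by simp
      ultimately show False using that n z e(2)[of k] by auto
    qed
    have ind: "U1 y * g (z - y) = U y * g (z - y)" "F1 y * g (z - y) = F y * g (z - y)"
      if "\<And>x. x \<notin> cball 0 (e k) \<Longrightarrow> g x = 0" for g y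
      using that[OF far[of y]] by (auto simp: U1_def F1_def indicator_def)
    have r1: "U1 y * p k (z - y) = U y * p k (z - y)" for y by (rule ind(1)) (rule \<rho>0(2))
    have r2: "U1 y * q k (z - y) = U y * q k (z - y)" for y by (rule ind(1)) (rule \<rho>0(3))
    have r3: "F1 y * \<rho> k (z - y) = F y * \<rho> k (z - y)" for y by (rule ind(2)) (rule \<rho>0(1))
    have i: "integrable lborel (\<lambda>y. U1 y * p k (z - y))" "integrable lborel (\<lambda>y. U1 y * q k (z - y))"
    proof -
      obtain B where "\<And>z. \<bar>p k z\<bar> \<le> B" using compact_support_bounded[OF c\<rho>(2) compact_cball \<rho>0(2)] by blast
      then show "integrable lborel (\<lambda>y. U1 y * p k (z - y))" by (rule convolution_integrable[OF U1 c\<rho>(2)])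
      obtain B where "\<And>z. \<bar>q k z\<bar> \<le> B" using compact_support_bounded[OF c\<rho>(3) compact_cball \<rho>0(3)] by blast
      then show "integrable lborel (\<lambda>y. U1 y * q k (z - y))" by (rule convolution_integrable[OF U1 c\<rho>(3)])
    qed
    have "(\<integral>y. U y * (- p k (z - y) + q k (z - y)) \<partial>lborel) = (\<integral>y. F y * \<rho> k (z - y) \<partial>lborel)"
      by (rule eq[OF C21_reflect[OF \<rho>(1)] e(3)[of k], where R="R + 1"]) (use far \<rho>0(1) in blast)
    also have "(\<integral>y. F y * \<rho> k (z - y) \<partial>lborel) = f k z"
      unfolding f_def convolution_def by (simp only: r3)
    also have "(\<integral>y. U y * (- p k (z - y) + q k (z - y)) \<partial>lborel) = (\<integral>y. - (U1 y * p k (z - y)) + U1 y * q k (z - y) \<partial>lborel)"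
      by (simp only: r1 r2 distrib_left mult_minus_right)
    also have "\<dots> = - convolution U1 (p k) z + convolution U1 (q k) z" using i by (simp add: convolution_def)
    finally show ?thesis by simp
  qed
  \<comment> \<open>Green's identity moves the derivatives from the test function to the regularised absolute value of the mollified solution.\<close>
  have smooth: "(\<integral>z. L z * smooth_abs d (w k z) \<partial>lborel) \<ge> (\<integral>z. \<phi> z * smooth_sgn d (w k z) * f k z \<partial>lborel)"
    if d: "d > 0" for d k
  proof -
    obtain b' where b': "C21 (\<lambda>z. smooth_abs d (w k z)) (\<lambda>z. smooth_sgn d (w k z) * convolution U1 (p k) z) b'"
       "\<And>z. b' z \<ge> smooth_sgn d (w k z) * convolution U1 (q k) z"
      using smooth_abs_subsolution[OF w d] by metis
    have c1: "continuous_on UNIV (\<lambda>z. smooth_sgn d (w k z))"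
    proof -
      have "continuous_on UNIV (smooth_sgn d)"
        using smooth_sgn_deriv[OF d] by (meson DERIV_isCont continuous_at_imp_continuous_on)
      then show ?thesis by (rule continuous_on_compose2[OF _ cw(1)]) auto
    qed
    note cb = C21_continuous[OF b'(1)]
    have "(\<integral>z. \<phi> z * smooth_sgn d (w k z) * f k z \<partial>lborel)
        \<le> (\<integral>z. \<phi> z * (- (smooth_sgn d (w k z) * convolution U1 (p k) z) + b' z) \<partial>lborel)"
    proof (rule integral_mono)
      show "integrable lborel (\<lambda>z. \<phi> z * smooth_sgn d (w k z) * f k z)"
        by (rule compact_support_integrable[OF _ compact_cball[of 0 R]])
           (use \<phi>0 in \<open>auto intro!: continuous_intros ca c1 cf\<close>)
      show "integrable lborel (\<lambda>z. \<phi> z * (- (smooth_sgn d (w k z) * convolution U1 (p k) z) + b' z))"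
        by (rule compact_support_integrable[OF _ compact_cball[of 0 R]])
           (use \<phi>0 in \<open>auto intro!: continuous_intros ca cb\<close>)
      fix z
      show "\<phi> z * smooth_sgn d (w k z) * f k z \<le> \<phi> z * (- (smooth_sgn d (w k z) * convolution U1 (p k) z) + b' z)"
      proof (cases "\<phi> z = 0")
        case False
        then have "norm z \<le> R" "snd z \<le> \<tau>" using \<phi>(4)[of z] by (auto simp: not_le[symmetric])
        from pde[OF this] have "smooth_sgn d (w k z) * f k z = - (smooth_sgn d (w k z) * convolution U1 (p k) z) + smooth_sgn d (w k z) * convolution U1 (q k) z"
          by (metis distrib_left mult_minus_right)
        also have "\<dots> \<le> - (smooth_sgn d (w k z) * convolution U1 (p k) z) + b' z" using b'(2)[of z] by simp
        finally show ?thesis using \<phi>(2)[of z] by (simp add: mult.assoc mult_left_mono)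
      qed simp
    qed
    also have "\<dots> = (\<integral>z. L z * smooth_abs d (w k z) \<partial>lborel)"
      unfolding L_def by (rule green_identity(2)[OF b'(1) \<phi>(1) compact_cball \<phi>0, symmetric])
    finally show ?thesis .
  qed
  obtain r where r: "strict_mono r" "AE z in lborel. (\<lambda>k. w (r k) z - U1 z) \<longlonglongrightarrow> 0"
    using tendsto_L1_AE_subseq[OF _ wlim] wi U1 by auto
  have reg: "(\<integral>z. L z * smooth_abs d (U1 z) \<partial>lborel) \<ge> 0" if d: "d > 0" for d
  proof -
    have c0: "continuous_on UNIV (smooth_sgn d)" "continuous_on UNIV (smooth_abs d)"
      using smooth_sgn_deriv[OF d] smooth_abs_deriv[OF d] by (meson DERIV_isCont continuous_at_imp_continuous_on)+
    note [measurable] = borel_measurable_continuous_onI[OF c0(1)] borel_measurable_continuous_onI[OF c0(2)]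
    have iLr: "integrable lborel (\<lambda>z. L z * smooth_abs d (u z))" if u: "integrable lborel u" for u
    proof -
      note [measurable] = u
      have "integrable lborel (\<lambda>z. L z * (smooth_abs d (u z) - \<bar>u z\<bar>))"
        by (rule integrable_mult_bounded[OF iL _ smooth_abs_near_abs[OF d]]) measurable
      moreover have "integrable lborel (\<lambda>z. \<bar>u z\<bar> * L z)"
        by (rule integrable_mult_bounded[OF _ _ BL(2)]) (use u in auto)
      ultimately have "integrable lborel (\<lambda>z. L z * (smooth_abs d (u z) - \<bar>u z\<bar>) + \<bar>u z\<bar> * L z)"
        by (rule Bochner_Integration.integrable_add)
      then show ?thesis by (simp add: right_diff_distrib mult.commute)
    qed
    have lhs: "(\<lambda>k. \<integral>z. L z * smooth_abs d (w k z) \<partial>lborel) \<longlonglongrightarrow> (\<integral>z. L z * smooth_abs d (U1 z) \<partial>lborel)"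
    proof (rule LIM_zero_cancel, rule Lim_null_comparison)
      show "(\<lambda>k. BL * (\<integral>z. norm (w k z - U1 z) \<partial>lborel)) \<longlonglongrightarrow> 0"
        using tendsto_mult[OF tendsto_const wlim, of BL] by simp
      show "\<forall>\<^sub>F k in sequentially. norm ((\<integral>z. L z * smooth_abs d (w k z) \<partial>lborel) - (\<integral>z. L z * smooth_abs d (U1 z) \<partial>lborel))
          \<le> BL * (\<integral>z. norm (w k z - U1 z) \<partial>lborel)"
      proof (rule always_eventually, rule allI)
        fix k
        have "norm ((\<integral>z. L z * smooth_abs d (w k z) \<partial>lborel) - (\<integral>z. L z * smooth_abs d (U1 z) \<partial>lborel))
            = norm (\<integral>z. L z * smooth_abs d (w k z) - L z * smooth_abs d (U1 z) \<partial>lborel)"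
          using iLr[OF wi] iLr[OF U1] by simp
        also have "\<dots> \<le> (\<integral>z. norm (L z * smooth_abs d (w k z) - L z * smooth_abs d (U1 z)) \<partial>lborel)" by simp
        also have "\<dots> \<le> (\<integral>z. BL * norm (w k z - U1 z) \<partial>lborel)"
        proof (rule integral_mono)
          fix z
          have "norm (L z * smooth_abs d (w k z) - L z * smooth_abs d (U1 z)) = \<bar>L z\<bar> * \<bar>smooth_abs d (w k z) - smooth_abs d (U1 z)\<bar>"
            by (simp add: right_diff_distrib[symmetric] abs_mult)
          also have "\<dots> \<le> BL * \<bar>w k z - U1 z\<bar>"
            using BL smooth_abs_lipschitz[OF d] by (intro mult_mono) auto
          finally show "norm (L z * smooth_abs d (w k z) - L z * smooth_abs d (U1 z)) \<le> BL * norm (w k z - U1 z)" by simp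
        qed (use iLr[OF wi] iLr[OF U1] wi U1 in auto)
        finally show "norm ((\<integral>z. L z * smooth_abs d (w k z) \<partial>lborel) - (\<integral>z. L z * smooth_abs d (U1 z) \<partial>lborel))
          \<le> BL * (\<integral>z. norm (w k z - U1 z) \<partial>lborel)" by simp
      qed
    qed
    have bd: "\<bar>\<phi> z * smooth_sgn d s\<bar> \<le> BP" for z s
      unfolding abs_mult using mult_mono[OF BP(2)[of z] abs_smooth_sgn_le[of d s]] BP(1) by simp
    have main: "(\<lambda>k. \<integral>z. F1 z * (\<phi> z * smooth_sgn d (w (r k) z)) \<partial>lborel) \<longlonglongrightarrow> (\<integral>z. F1 z * (\<phi> z * smooth_sgn d (U1 z)) \<partial>lborel)"
    proof (rule integral_dominated_convergence[where w="\<lambda>z. BP * \<bar>F1 z\<bar>"])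
      show "AE z in lborel. norm (F1 z * (\<phi> z * smooth_sgn d (w (r k) z))) \<le> BP * \<bar>F1 z\<bar>" for k
        by (rule AE_I2) (subst real_norm_def, subst abs_mult, subst mult.commute, rule mult_right_mono, auto intro: bd)
      show "AE z in lborel. (\<lambda>k. F1 z * (\<phi> z * smooth_sgn d (w (r k) z))) \<longlonglongrightarrow> F1 z * (\<phi> z * smooth_sgn d (U1 z))"
        using r(2)
      proof (rule eventually_mono)
        fix z assume "(\<lambda>k. w (r k) z - U1 z) \<longlonglongrightarrow> 0"
        then have "(\<lambda>k. w (r k) z) \<longlonglongrightarrow> U1 z" by (rule LIM_zero_cancel)
        moreover have "isCont (smooth_sgn d) (U1 z)" using c0 by (simp add: continuous_on_eq_continuous_at)
        ultimately show "(\<lambda>k. F1 z * (\<phi> z * smooth_sgn d (w (r k) z))) \<longlonglongrightarrow> F1 z * (\<phi> z * smooth_sgn d (U1 z))"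
          by (intro tendsto_intros) (rule isCont_tendsto_compose)
      qed
    qed (use F1 in auto)
    have rest: "(\<lambda>k. \<integral>z. (f k z - F1 z) * (\<phi> z * smooth_sgn d (w k z)) \<partial>lborel) \<longlonglongrightarrow> 0"
    proof (rule Lim_null_comparison)
      show "(\<lambda>k. BP * (\<integral>z. norm (f k z - F1 z) \<partial>lborel)) \<longlonglongrightarrow> 0"
        using tendsto_mult[OF tendsto_const flim, of BP] by simp
      show "\<forall>\<^sub>F k in sequentially. norm (\<integral>z. (f k z - F1 z) * (\<phi> z * smooth_sgn d (w k z)) \<partial>lborel)
          \<le> BP * (\<integral>z. norm (f k z - F1 z) \<partial>lborel)"
      proof (rule always_eventually, rule allI)
        fix k
        have fF: "integrable lborel (\<lambda>z. f k z - F1 z)" using fi F1 by simp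
        have "norm (\<integral>z. (f k z - F1 z) * (\<phi> z * smooth_sgn d (w k z)) \<partial>lborel)
            \<le> (\<integral>z. norm ((f k z - F1 z) * (\<phi> z * smooth_sgn d (w k z))) \<partial>lborel)" by simp
        also have "\<dots> \<le> (\<integral>z. BP * norm (f k z - F1 z) \<partial>lborel)"
        proof (rule integral_mono)
          show "integrable lborel (\<lambda>z. norm ((f k z - F1 z) * (\<phi> z * smooth_sgn d (w k z))))"
            by (intro integrable_norm integrable_mult_bounded[OF fF _ bd]) measurable
          show "norm ((f k z - F1 z) * (\<phi> z * smooth_sgn d (w k z))) \<le> BP * norm (f k z - F1 z)" for z
            by (subst real_norm_def, subst abs_mult, subst mult.commute, subst real_norm_def, rule mult_right_mono, auto intro: bd)
        qed (use fF in auto)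
        finally show "norm (\<integral>z. (f k z - F1 z) * (\<phi> z * smooth_sgn d (w k z)) \<partial>lborel)
          \<le> BP * (\<integral>z. norm (f k z - F1 z) \<partial>lborel)" by simp
      qed
    qed
    have "(\<lambda>k. (\<integral>z. F1 z * (\<phi> z * smooth_sgn d (w (r k) z)) \<partial>lborel) + (\<integral>z. (f (r k) z - F1 z) * (\<phi> z * smooth_sgn d (w (r k) z)) \<partial>lborel))
        \<longlonglongrightarrow> (\<integral>z. F1 z * (\<phi> z * smooth_sgn d (U1 z)) \<partial>lborel) + 0"
      using LIMSEQ_subseq_LIMSEQ[OF rest r(1)] by (intro tendsto_add main) (simp add: comp_def)
    moreover have "(\<integral>z. F1 z * (\<phi> z * smooth_sgn d (w k z)) \<partial>lborel) + (\<integral>z. (f k z - F1 z) * (\<phi> z * smooth_sgn d (w k z)) \<partial>lborel)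
        = (\<integral>z. \<phi> z * smooth_sgn d (w k z) * f k z \<partial>lborel)" for k
    proof -
      have "integrable lborel (\<lambda>z. F1 z * (\<phi> z * smooth_sgn d (w k z)))"
        by (rule integrable_mult_bounded[OF F1 _ bd]) measurable
      moreover have "integrable lborel (\<lambda>z. (f k z - F1 z) * (\<phi> z * smooth_sgn d (w k z)))"
        by (rule integrable_mult_bounded[OF _ _ bd]) (use fi F1 in auto)
      ultimately show ?thesis
        by (subst Bochner_Integration.integral_add[symmetric]) (auto simp: algebra_simps)
    qed
    ultimately have rhs: "(\<lambda>k. \<integral>z. \<phi> z * smooth_sgn d (w (r k) z) * f (r k) z \<partial>lborel)
        \<longlonglongrightarrow> (\<integral>z. F1 z * (\<phi> z * smooth_sgn d (U1 z)) \<partial>lborel)" by simp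
    have "(\<integral>z. F1 z * (\<phi> z * smooth_sgn d (U1 z)) \<partial>lborel) \<le> (\<integral>z. L z * smooth_abs d (U1 z) \<partial>lborel)"
      by (rule LIMSEQ_le[OF rhs LIMSEQ_subseq_LIMSEQ[OF lhs r(1), unfolded comp_def]])
         (use smooth[OF d] in auto)
    moreover have "(\<integral>z. F1 z * (\<phi> z * smooth_sgn d (U1 z)) \<partial>lborel) \<ge> 0"
    proof (rule integral_nonneg_AE, use sign in \<open>rule eventually_mono\<close>)
      fix z assume "0 \<le> U z * F z"
      then have "0 \<le> U1 z * F1 z" by (simp add: U1_def F1_def indicator_def)
      then have "0 \<le> smooth_sgn d (U1 z) * F1 z" by (simp add: smooth_sgn_def)
      then have "0 \<le> \<phi> z * (smooth_sgn d (U1 z) * F1 z)" using \<phi>(2)[of z] by (rule mult_nonneg_nonneg[rotated])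
      then show "0 \<le> F1 z * (\<phi> z * smooth_sgn d (U1 z))" by (simp add: mult_ac)
    qed
    ultimately show ?thesis by linarith
  qed
  have iU: "integrable lborel (\<lambda>z. \<bar>U1 z\<bar> * L z)"
    by (rule integrable_mult_bounded[OF _ _ BL(2)]) (use U1 in auto)
  \<comment> \<open>The error of replacing \<open>smooth_abs d\<close> by the absolute value is at most \<open>d\<close> times the integral of \<open>\<bar>L\<bar>\<close>.\<close>
  have "- (\<integral>z. \<bar>U1 z\<bar> * L z \<partial>lborel) \<le> 0"
  proof (rule field_le_epsilon)
    fix \<eta> :: real assume "\<eta> > 0"
    let ?N = "\<integral>z. \<bar>L z\<bar> \<partial>lborel"
    define d where "d = \<eta> / (?N + 1)"
    have N: "?N \<ge> 0" by simp
    have "\<eta> / (N + 1) > 0 \<and> \<eta> / (N + 1) * N \<le> \<eta>" if "N \<ge> 0" for N :: real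
      using that \<open>\<eta> > 0\<close> by (simp add: field_simps)
    from this[OF N] have d: "d > 0" "d * ?N \<le> \<eta>" by (auto simp: d_def)
    have i2: "integrable lborel (\<lambda>z. L z * (smooth_abs d (U1 z) - \<bar>U1 z\<bar>))"
    proof (rule integrable_mult_bounded[OF iL _ smooth_abs_near_abs[OF d(1)]])
      have "continuous_on UNIV (smooth_abs d)" using smooth_abs_deriv[OF d(1)] by (meson DERIV_isCont continuous_at_imp_continuous_on)
      note [measurable] = borel_measurable_continuous_onI[OF this]
      show "(\<lambda>z. smooth_abs d (U1 z) - \<bar>U1 z\<bar>) \<in> borel_measurable borel" using U1 by measurable
    qed
    have "0 \<le> (\<integral>z. L z * smooth_abs d (U1 z) \<partial>lborel)" by (rule reg[OF d(1)])
    also have "\<dots> = (\<integral>z. \<bar>U1 z\<bar> * L z + L z * (smooth_abs d (U1 z) - \<bar>U1 z\<bar>) \<partial>lborel)" by (simp add: algebra_simps)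
    also have "\<dots> = (\<integral>z. \<bar>U1 z\<bar> * L z \<partial>lborel) + (\<integral>z. L z * (smooth_abs d (U1 z) - \<bar>U1 z\<bar>) \<partial>lborel)"
      using iU i2 by (rule Bochner_Integration.integral_add)
    also have "(\<integral>z. L z * (smooth_abs d (U1 z) - \<bar>U1 z\<bar>) \<partial>lborel) \<le> (\<integral>z. d * \<bar>L z\<bar> \<partial>lborel)"
    proof (rule integral_mono[OF i2])
      show "integrable lborel (\<lambda>z. d * \<bar>L z\<bar>)" using iL by simp
      show "L z * (smooth_abs d (U1 z) - \<bar>U1 z\<bar>) \<le> d * \<bar>L z\<bar>" for z
      proof -
        have "L z * (smooth_abs d (U1 z) - \<bar>U1 z\<bar>) \<le> \<bar>L z\<bar> * \<bar>smooth_abs d (U1 z) - \<bar>U1 z\<bar>\<bar>"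
          by (metis abs_ge_self abs_mult)
        also have "\<dots> \<le> \<bar>L z\<bar> * d" using smooth_abs_near_abs[OF d(1)] by (intro mult_left_mono) auto
        finally show ?thesis by (simp add: mult.commute)
      qed
    qed
    finally show "- (\<integral>z. \<bar>U1 z\<bar> * L z \<partial>lborel) \<le> 0 + \<eta>" using d(2) by simp
  qed
  also have "(\<integral>z. \<bar>U1 z\<bar> * L z \<partial>lborel) = (\<integral>z. \<bar>U z\<bar> * (a z + b z) \<partial>lborel)"
  proof (rule Bochner_Integration.integral_cong)
    fix z show "\<bar>U1 z\<bar> * L z = \<bar>U z\<bar> * (a z + b z)"
      using L0[of z] by (cases "norm z \<le> R") (auto simp: U1_def L_def)
  qed simp
  finally show ?thesis by simp
qed

section \<open>Weak solutions as distributional solutions\<close>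

lemma smooth_has_dir_deriv:
  assumes "\<And>k. Ck k f"
  shows "has_dir_deriv v f (dderiv v f)" and "\<And>k. Ck k (dderiv v f)"
proof -
  have d: "f differentiable (at z)" for z using assms[of "Suc 0"] by simp
  show C: "Ck k (dderiv v f)" for k using assms[of "Suc k"] by simp
  have "((\<lambda>s. f (z + s *\<^sub>R v)) has_real_derivative dderiv v f z) (at 0)" for z
  proof -
    have "(f has_derivative frechet_derivative f (at z)) (at (z + 0 *\<^sub>R v))"
      using d[of z] frechet_derivative_works by auto
    moreover have "((\<lambda>s. z + s *\<^sub>R v) has_derivative (\<lambda>s. s *\<^sub>R v)) (at 0)"
      by (auto intro!: derivative_eq_intros)
    ultimately have "((\<lambda>s. f (z + s *\<^sub>R v)) has_derivative (\<lambda>s. frechet_derivative f (at z) (s *\<^sub>R v))) (at 0)"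
      using has_derivative_compose by blast
    moreover have "frechet_derivative f (at z) (s *\<^sub>R v) = dderiv v f z * s" for s
      using linear_frechet_derivative[OF d[of z]] by (simp add: dderiv_def linear_scale)
    ultimately show ?thesis by (simp add: has_field_derivative_def)
  qed
  moreover have "continuous_on UNIV f"
    using d by (meson differentiable_imp_continuous_within continuous_at_imp_continuous_on)
  moreover have "continuous_on UNIV (dderiv v f)" using C[of 0] by simp
  ultimately show "has_dir_deriv v f (dderiv v f)" by (simp add: has_dir_deriv_def)
qed

lemma smooth_C21:
  assumes "\<And>k. Ck k f"
  shows "C21 f (time_deriv f) (space_laplacian f)"
  unfolding C21_def time_deriv_def
  by (intro conjI smooth_has_dir_deriv assms exI[of _ "\<lambda>i. dderiv (axis i 1, 0) f"]
        exI[of _ "\<lambda>i. dderiv (axis i 1, 0) (dderiv (axis i 1, 0) f)"] allI)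
     (simp add: space_laplacian_def fun_eq_iff)

lemma Q_sets [measurable]: "Q T \<in> sets borel" "Qbar T \<in> sets borel"
  unfolding Q_def Qbar_def by (intro borel_open borel_closed open_Times closed_Times; simp)+

text \<open>
  For a \<open>C\<^sup>2\<^sup>,\<^sup>1\<close> function the distributional heat operator is the classical one, by Green's identity
  against compactly supported smooth functions.
\<close>

lemma C21_backward_heat:
  fixes \<phi> :: "(real^'n) \<times> real \<Rightarrow> real"
  assumes \<phi>: "C21 \<phi> a b"
  shows "backward_heat T \<phi> (\<lambda>z. a z + b z)"
  unfolding backward_heat_def
proof (intro conjI ballI)
  note c = C21_continuous[OF \<phi>]
  have cg: "continuous_on UNIV (\<lambda>z. a z + b z)" by (intro continuous_intros c)
  note [measurable] = borel_measurable_continuous_onI[OF cg]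
  have "(\<lambda>z. indicator (Qbar T) z *\<^sub>R (a z + b z)) \<in> borel_measurable borel" by measurable
  then have "(\<lambda>z. indicator (Qbar T) z *\<^sub>R (a z + b z)) \<in> borel_measurable lebesgue"
    by (intro measurable_completion) simp
  moreover have "\<exists>C. AE z in lebesgue. z \<in> K \<longrightarrow> \<bar>a z + b z\<bar> \<le> C" if "compact K" for K
  proof -
    have "bounded ((\<lambda>z. a z + b z) ` K)"
      by (intro compact_imp_bounded compact_continuous_image that continuous_on_subset[OF cg]) auto
    then obtain C where "\<And>z. z \<in> K \<Longrightarrow> \<bar>a z + b z\<bar> \<le> C" by (auto simp: bounded_iff)
    then show ?thesis by (intro exI[of _ C] AE_I2) auto
  qed
  ultimately show "(\<lambda>z. a z + b z) \<in> Linf_loc (Qbar T)"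
    by (auto simp: Linf_loc_def set_borel_measurable_def)
  fix \<psi> :: "(real^'n) \<times> real \<Rightarrow> real" assume "\<psi> \<in> test_functions (Q T)"
  then obtain K where \<psi>: "\<And>k. Ck k \<psi>" and K: "compact K" "K \<subseteq> Q T" "\<And>z. z \<notin> K \<Longrightarrow> \<psi> z = 0"
    unfolding test_functions_def by auto
  note S = smooth_C21[OF \<psi>]
  note z = C21_eq_0_off_support[OF S compact_imp_closed[OF K(1)] K(3)]
  note cS = C21_continuous[OF S]
  have c1: "continuous_on UNIV (\<lambda>z. \<phi> z * (- time_deriv \<psi> z + space_laplacian \<psi> z))"
    and c2: "continuous_on UNIV (\<lambda>z. (a z + b z) * \<psi> z)" by (intro continuous_intros c cS)+
  have "(LINT z:Q T|lebesgue. \<phi> z * (- time_deriv \<psi> z + space_laplacian \<psi> z))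
      = (LINT z|lebesgue. \<phi> z * (- time_deriv \<psi> z + space_laplacian \<psi> z))"
    unfolding set_lebesgue_integral_def
  proof (intro Bochner_Integration.integral_cong refl)
    fix x
    show "indicat_real (Q T) x *\<^sub>R (\<phi> x * (- time_deriv \<psi> x + space_laplacian \<psi> x))
        = \<phi> x * (- time_deriv \<psi> x + space_laplacian \<psi> x)"
      using K(2) z[of x] by (cases "x \<in> K") auto
  qed
  also have "\<dots> = (LINT z|lborel. \<phi> z * (- time_deriv \<psi> z + space_laplacian \<psi> z))"
    by (rule integral_completion) (use borel_measurable_continuous_onI[OF c1] in simp)
  also have "\<dots> = (LINT z|lborel. (a z + b z) * \<psi> z)"
    by (rule green_identity(1)[OF \<phi> S K(1,3), symmetric])
  also have "\<dots> = (LINT z|lebesgue. (a z + b z) * \<psi> z)"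
    by (rule integral_completion[symmetric]) (use borel_measurable_continuous_onI[OF c2] in simp)
  also have "\<dots> = (LINT z:Q T|lebesgue. (a z + b z) * \<psi> z)"
    unfolding set_lebesgue_integral_def using K(2,3)
    by (intro Bochner_Integration.integral_cong) (auto simp: indicator_def)
  finally show "(LINT z:Q T|lebesgue. \<phi> z * (- time_deriv \<psi> z + space_laplacian \<psi> z))
      = (LINT z:Q T|lebesgue. (a z + b z) * \<psi> z)" .
qed

lemma Qbar_closed: "closed (Qbar T)" unfolding Qbar_def by (intro closed_Times) auto

lemma C21_in_X:
  assumes \<phi>: "C21 \<phi> a b" and z: "\<tau> < T" "\<And>z. norm z > R \<or> snd z > \<tau> \<Longrightarrow> \<phi> z = 0"
  shows "\<phi> \<in> X T"
  unfolding X_def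
proof (intro CollectI conjI allI)
  show "continuous_on (Qbar T) \<phi>" using C21_continuous(1)[OF \<phi>] by (rule continuous_on_subset) simp
  show "\<exists>K. compact K \<and> K \<subseteq> Qbar T \<and> (\<forall>z\<in>Qbar T - K. \<phi> z = 0)"
  proof (intro exI conjI ballI)
    show "compact (cball 0 R \<inter> Qbar T)" by (intro compact_Int_closed compact_cball Qbar_closed)
    show "\<phi> x = 0" if "x \<in> Qbar T - cball 0 R \<inter> Qbar T" for x using that by (intro z(2)) auto
  qed simp
  show "\<exists>g. backward_heat T \<phi> g" using C21_backward_heat[OF \<phi>] by blast
  show "\<phi> (x, T) = 0" for x using z(1) by (intro z(2)) simp
qed

text \<open>
  The extension of \<open>u\<close> by zero from \<open>Q T\<close> to all times, as a Borel function, so that product measures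
  and translations of \<open>lborel\<close> apply to it. Local integrability up to the closed boundary of \<open>Qbar T\<close> is what
  makes the extension locally integrable across \<open>t = 0\<close>.
\<close>

lemma L1_loc_borel_extension:
  fixes u :: "(real^'n) \<times> real \<Rightarrow> real"
  assumes u: "u \<in> L1_loc (Qbar T)"
  obtains U where "U \<in> borel_measurable borel" "AE z in lborel. indicator (Q T) z * u z = U z"
    "\<And>R. integrable lborel (\<lambda>z. indicator (cball 0 R) z * U z)"
    "\<And>g. g \<in> borel_measurable borel \<Longrightarrow> (LINT z:Q T|lebesgue. u z * g z) = (\<integral>z. U z * g z \<partial>lborel)"
proof -
  have QQ: "Q T \<subseteq> Qbar T" by (auto simp: Q_def Qbar_def)
  have Ql: "Q T \<in> sets lebesgue" using Q_sets(1) by auto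
  have m0: "(\<lambda>z. indicator (Qbar T) z *\<^sub>R u z) \<in> borel_measurable lebesgue"
    using u by (auto simp: L1_loc_def set_borel_measurable_def)
  have "(\<lambda>z. indicator (Q T) z * (indicator (Qbar T) z *\<^sub>R u z)) \<in> borel_measurable lebesgue"
    using Ql m0 by (intro borel_measurable_times borel_measurable_indicator)
  also have "(\<lambda>z. indicator (Q T) z * (indicator (Qbar T) z *\<^sub>R u z)) = (\<lambda>z. indicator (Q T) z * u z)"
    using QQ by (auto simp: indicator_def fun_eq_iff)
  finally have m: "(\<lambda>z. indicator (Q T) z * u z) \<in> borel_measurable lebesgue" .
  obtain U where U: "U \<in> borel_measurable lborel" "AE z in lborel. indicator (Q T) z * u z = U z"
    using completion_ex_borel_measurable_real[OF m] by auto
  have Ub[measurable]: "U \<in> borel_measurable borel" using U(1) by simp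
  have Ul: "AE z in lebesgue. indicator (Q T) z * u z = U z" using U(2) by (rule AE_completion)
  have Um: "U \<in> borel_measurable lebesgue" using U(1) by (rule measurable_completion)
  show thesis
  proof (rule that[OF Ub U(2)])
    fix R :: real
    let ?K = "cball 0 R :: ((real^'n) \<times> real) set"
    have "compact (?K \<inter> Qbar T)" by (intro compact_Int_closed compact_cball Qbar_closed)
    then have "set_integrable lebesgue (?K \<inter> Qbar T) u" using u by (auto simp: L1_loc_def)
    then have "set_integrable lebesgue (?K \<inter> Q T) u"
      by (rule set_integrable_subset) (use QQ Ql in auto)
    then have i: "integrable lebesgue (\<lambda>z. indicator (?K \<inter> Q T) z *\<^sub>R u z)" by (simp add: set_integrable_def)
    have ae: "AE z in lebesgue. indicator (?K \<inter> Q T) z *\<^sub>R u z = indicator ?K z * U z"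
      using Ul by (rule eventually_mono) (auto simp: indicator_def split: if_splits)
    have mb: "(\<lambda>z. indicator ?K z * U z) \<in> borel_measurable lborel"
      using Ub by (auto intro!: borel_measurable_times borel_measurable_indicator)
    then have mm: "(\<lambda>z. indicator ?K z * U z) \<in> borel_measurable lebesgue"
      by (rule measurable_completion)
    have "integrable lebesgue (\<lambda>z. indicator ?K z * U z)"
      by (rule integrable_cong_AE_imp[OF i mm]) (use ae in \<open>auto elim: eventually_mono\<close>)
    then show "integrable lborel (\<lambda>z. indicator ?K z * U z)"
      by (simp only: integrable_completion[OF mb])
  next
    fix g :: "(real^'n) \<times> real \<Rightarrow> real" assume g[measurable]: "g \<in> borel_measurable borel"
    have gl: "g \<in> borel_measurable lebesgue" by (intro measurable_completion) simp
    have "(LINT z:Q T|lebesgue. u z * g z) = (\<integral>z. (indicator (Q T) z * u z) * g z \<partial>lebesgue)"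
      by (simp add: set_lebesgue_integral_def mult.assoc)
    also have "\<dots> = (\<integral>z. U z * g z \<partial>lebesgue)"
      by (rule integral_cong_AE)
         (use m gl Um Ul in \<open>auto intro!: borel_measurable_times elim: eventually_mono\<close>)
    also have "\<dots> = (\<integral>z. U z * g z \<partial>lborel)" by (rule integral_completion) simp
    finally show "(LINT z:Q T|lebesgue. u z * g z) = (\<integral>z. U z * g z \<partial>lborel)" .
  qed
qed

section \<open>A Gaussian barrier and propagation of the zero set\<close>

text \<open>
  The test function of the uniqueness step, as a function of \<open>p = \<bar>x\<bar>\<^sup>2\<close> and \<open>t\<close>. The time factor
  \<open>pos_cube (r\<^sup>2 - t\<^sup>2)\<close> has compact support, as a test function on all times must, and decreases for
  \<open>t \<ge> 0\<close>.
\<close>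

definition barrier :: "real \<Rightarrow> real \<Rightarrow> real \<Rightarrow> real \<Rightarrow> real \<Rightarrow> real \<Rightarrow> real" where
  "barrier \<kappa> s r R p t = pos_cube (1 - p / R\<^sup>2) * exp (- (2 * \<kappa> + 64 * \<kappa>\<^sup>2 * (t - s)) * p) * pos_cube (r\<^sup>2 - t\<^sup>2)"

text \<open>
  The part of \<open>- \<partial>\<^sub>t barrier\<close> that comes from the decrease of the time factor.
\<close>

definition barrier_loss :: "real \<Rightarrow> real \<Rightarrow> real \<Rightarrow> real \<Rightarrow> real \<Rightarrow> real \<Rightarrow> real" where
  "barrier_loss \<kappa> s r R p t = pos_cube (1 - p / R\<^sup>2) * exp (- (2 * \<kappa> + 64 * \<kappa>\<^sup>2 * (t - s)) * p) * (2 * t * pos_cube' (r\<^sup>2 - t\<^sup>2))"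

text \<open>
  On the time interval considered the exponent \<open>\<alpha>\<close> lies between \<open>2 \<kappa>\<close> and \<open>4 \<kappa>\<close>. Hence
  \<open>4 \<alpha>\<^sup>2\<close> is at most the slope \<open>64 \<kappa>\<^sup>2\<close>, which disposes of the terms without derivatives of the
  spatial cutoff. The first-order terms have a sign, except the cross term \<open>8 \<alpha> p\<close> times the derivative of
  the cutoff, which is at most \<open>96 \<kappa> p / R\<^sup>2\<close>; the second derivative of the cutoff contributes at most
  \<open>24 / R\<^sup>2\<close>, as it lives on \<open>p \<le> R\<^sup>2\<close>. One of the two factors \<open>exp (- \<kappa> p)\<close> available absorbs
  \<open>\<kappa> p\<close>, and \<open>24 + 96 = 120\<close>.
\<close>

lemma barrier_C21:
  fixes \<kappa> s r R :: real
  assumes "\<kappa> > 0" "R > 0"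
  obtains a b where "C21 (\<lambda>z::(real^'n) \<times> real. barrier \<kappa> s r R ((norm (fst z))\<^sup>2) (snd z)) a b"
    "\<And>z. s \<le> snd z \<Longrightarrow> snd z \<le> s + 1 / (32 * \<kappa>) \<Longrightarrow>
      a z + b z \<le> - barrier_loss \<kappa> s r R ((norm (fst z))\<^sup>2) (snd z)
        + 120 / R\<^sup>2 * pos_cube (r\<^sup>2 - (snd z)\<^sup>2) * exp (- \<kappa> * (norm (fst z))\<^sup>2)"
    "\<And>z. (snd z)\<^sup>2 \<ge> r\<^sup>2 \<Longrightarrow> a z + b z = 0"
proof -
  let ?\<alpha> = "\<lambda>t. 2 * \<kappa> + 64 * \<kappa>\<^sup>2 * (t - s)"
  let ?q = "\<lambda>p. 1 - p / R\<^sup>2"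
  let ?e = "\<lambda>p t. exp (- ?\<alpha> t * p)"
  let ?\<theta> = "\<lambda>t. pos_cube (r\<^sup>2 - t\<^sup>2)"
  let ?Gp = "\<lambda>p t. (- pos_cube' (?q p) / R\<^sup>2 - ?\<alpha> t * pos_cube (?q p)) * ?e p t * ?\<theta> t"
  let ?Gpp = "\<lambda>p t. (pos_cube'' (?q p) / R\<^sup>2 / R\<^sup>2 + 2 * ?\<alpha> t * pos_cube' (?q p) / R\<^sup>2 + (?\<alpha> t)\<^sup>2 * pos_cube (?q p)) * ?e p t * ?\<theta> t"
  let ?Gt = "\<lambda>p t. pos_cube (?q p) * ?e p t * (- 64 * \<kappa>\<^sup>2 * p) * ?\<theta> t + pos_cube (?q p) * ?e p t * (pos_cube' (r\<^sup>2 - t\<^sup>2) * (- 2 * t))"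
  note R = assms(2)
  have alg: "((- (- B2 / Q) / Q - A * (- B1 / Q)) * E + (- A * E) * (- B1 / Q - A * B)) * H
      = (B2 / Q / Q + 2 * A * B1 / Q + A\<^sup>2 * B) * E * H" for A B B1 B2 E H Q :: real
    by (simp add: divide_inverse power2_eq_square algebra_simps)
  have dq: "(?q has_real_derivative - 1 / R\<^sup>2) (at p)" for p
    by (rule DERIV_cong[OF DERIV_diff[OF DERIV_const DERIV_cdivide[OF DERIV_ident]]]) simp
  have db: "((\<lambda>p. pos_cube (?q p)) has_real_derivative - pos_cube' (?q p) / R\<^sup>2) (at p)"
    "((\<lambda>p. pos_cube' (?q p)) has_real_derivative - pos_cube'' (?q p) / R\<^sup>2) (at p)" for p
    using DERIV_chain2[OF pos_cube_deriv dq] DERIV_chain2[OF pos_cube'_deriv dq] by auto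
  have de: "((\<lambda>p. ?e p t) has_real_derivative - ?\<alpha> t * ?e p t) (at p)" for p t
    by (auto intro!: derivative_eq_intros)
  have det: "((\<lambda>t. ?e p t) has_real_derivative ?e p t * (- 64 * \<kappa>\<^sup>2 * p)) (at t)" for p t
    by (auto intro!: derivative_eq_intros)
  have dt: "((\<lambda>t. r\<^sup>2 - t\<^sup>2) has_real_derivative - 2 * t) (at t)" for t
    by (auto intro!: derivative_eq_intros)
  have d\<theta>: "(?\<theta> has_real_derivative pos_cube' (r\<^sup>2 - t\<^sup>2) * (- 2 * t)) (at t)" for t
    by (rule DERIV_chain2[OF pos_cube_deriv dt])
  have C: "C21 (\<lambda>z::(real^'n) \<times> real. barrier \<kappa> s r R ((norm (fst z))\<^sup>2) (snd z))
     (\<lambda>z. ?Gt ((norm (fst z))\<^sup>2) (snd z))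
     (\<lambda>z. 4 * (norm (fst z))\<^sup>2 * ?Gpp ((norm (fst z))\<^sup>2) (snd z) + 2 * CARD('n) * ?Gp ((norm (fst z))\<^sup>2) (snd z))"
  proof (rule radial_C21)
    fix p t
    have "((\<lambda>p. pos_cube (?q p) * ?e p t * ?\<theta> t) has_real_derivative
        ((- pos_cube' (?q p) / R\<^sup>2) * ?e p t + (- ?\<alpha> t * ?e p t) * pos_cube (?q p)) * ?\<theta> t) (at p)"
      by (intro DERIV_cmult_right DERIV_mult db de)
    then show "((\<lambda>p. barrier \<kappa> s r R p t) has_real_derivative ?Gp p t) (at p)"
      unfolding barrier_def by (rule DERIV_cong) (simp add: algebra_simps)
    have "((\<lambda>p. - pos_cube' (?q p) / R\<^sup>2 - ?\<alpha> t * pos_cube (?q p)) has_real_derivative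
        - (- pos_cube'' (?q p) / R\<^sup>2) / R\<^sup>2 - ?\<alpha> t * (- pos_cube' (?q p) / R\<^sup>2)) (at p)"
      by (intro DERIV_diff DERIV_cdivide DERIV_minus DERIV_cmult db)
    from DERIV_cmult_right[OF DERIV_mult[OF this de[where t=t]], where c="?\<theta> t"]
    show "((\<lambda>p. ?Gp p t) has_real_derivative ?Gpp p t) (at p)"
      by (rule DERIV_cong) (rule alg)
    from DERIV_mult[OF DERIV_cmult[OF det, of "pos_cube (?q p)"] d\<theta>]
    have "((\<lambda>t. pos_cube (?q p) * ?e p t * ?\<theta> t) has_real_derivative ?Gt p t) (at t)"
      by (rule DERIV_cong) (simp add: algebra_simps)
    then show "(barrier \<kappa> s r R p has_real_derivative ?Gt p t) (at t)"
      by (simp add: barrier_def[abs_def])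
  qed (unfold barrier_def, (intro continuous_intros continuous_pos_cube; use R in simp)+)
  show thesis
  proof (rule that[OF C])
    fix z :: "(real^'n) \<times> real"
    let ?p = "(norm (fst z))\<^sup>2" and ?t = "snd z"
    show "?Gt ?p ?t + (4 * ?p * ?Gpp ?p ?t + 2 * CARD('n) * ?Gp ?p ?t) = 0" if "?t\<^sup>2 \<ge> r\<^sup>2"
      using that by (simp add: pos_cube_simps)
    assume t: "s \<le> ?t" "?t \<le> s + 1 / (32 * \<kappa>)"
    define p where "p = ?p"
    define \<alpha> where "\<alpha> = ?\<alpha> ?t"
    define e where "e = exp (- \<alpha> * p)"
    define \<theta> where "\<theta> = ?\<theta> ?t"
    define B B1 B2 where "B = pos_cube (?q p)" and "B1 = pos_cube' (?q p)" and "B2 = pos_cube'' (?q p)"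
    have p: "p \<ge> 0" by (simp add: p_def)
    have B: "B \<ge> 0" "B1 \<ge> 0" "B2 \<ge> 0" "\<theta> \<ge> 0" by (auto simp: B_def B1_def B2_def \<theta>_def pos_cube_simps)
    have \<alpha>1: "2 * \<kappa> \<le> \<alpha>" unfolding \<alpha>_def using t(1) by simp
    have \<alpha>2: "\<alpha> \<le> 4 * \<kappa>"
    proof -
      have "64 * \<kappa>\<^sup>2 * (?t - s) \<le> 64 * \<kappa>\<^sup>2 * (1 / (32 * \<kappa>))" using t(2) by (intro mult_left_mono) auto
      also have "\<dots> = 2 * \<kappa>" using assms(1) by (simp add: power2_eq_square)
      finally show ?thesis by (simp add: \<alpha>_def)
    qed
    have \<alpha>0: "\<alpha> \<ge> 0" using \<alpha>1 assms(1) by simp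
    have i1: "4 * p * B2 / R\<^sup>2 / R\<^sup>2 \<le> 24 / R\<^sup>2"
    proof (cases "p \<le> R\<^sup>2")
      case True
      have q: "?q p \<le> 1" "?q p \<ge> 0" using p True R by (auto simp: field_simps)
      have "p * B2 \<le> R\<^sup>2 * 6" using True p q B by (intro mult_mono) (auto simp: B2_def pos_cube''_def)
      then have "4 * p * B2 / R\<^sup>2 / R\<^sup>2 \<le> 4 * (R\<^sup>2 * 6) / R\<^sup>2 / R\<^sup>2"
        by (intro divide_right_mono) (simp_all add: mult_ac)
      then show ?thesis using R by simp
    next
      case False
      then have "B2 = 0" unfolding B2_def using R by (intro pos_cube_simps) (simp add: field_simps)
      then show ?thesis by simp
    qed
    have i2: "8 * \<alpha> * p * B1 / R\<^sup>2 \<le> 96 * \<kappa> * p / R\<^sup>2"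
    proof -
      have "?q p \<le> 1" using p by simp
      then have "max 0 (?q p) ^ 2 \<le> 1" by (intro power_le_one) auto
      then have "B1 \<le> 3" by (simp add: B1_def pos_cube'_def)
      then have "\<alpha> * p * B1 \<le> (4 * \<kappa>) * p * 3" using \<alpha>2 \<alpha>0 p B assms(1) by (intro mult_mono) auto
      then show ?thesis by (intro divide_right_mono) (auto simp: algebra_simps)
    qed
    have i3: "4 * p * \<alpha>\<^sup>2 * B - 64 * \<kappa>\<^sup>2 * p * B \<le> 0"
    proof -
      have "\<alpha>\<^sup>2 \<le> (4 * \<kappa>)\<^sup>2" using \<alpha>2 \<alpha>0 by (intro power_mono) auto
      then have "4 * \<alpha>\<^sup>2 * (p * B) \<le> 64 * \<kappa>\<^sup>2 * (p * B)" using p B by (intro mult_right_mono) (auto simp: power_mult_distrib)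
      then show ?thesis by (simp add: algebra_simps)
    qed
    have i4: "2 * CARD('n) * (- B1 / R\<^sup>2 - \<alpha> * B) \<le> 0"
    proof -
      have "B1 / R\<^sup>2 \<ge> 0" "\<alpha> * B \<ge> 0" using B \<alpha>0 by auto
      then show ?thesis by (intro mult_nonneg_nonpos) auto
    qed
    have "- 64 * \<kappa>\<^sup>2 * p * B + 4 * p * (B2 / R\<^sup>2 / R\<^sup>2 + 2 * \<alpha> * B1 / R\<^sup>2 + \<alpha>\<^sup>2 * B) + 2 * CARD('n) * (- B1 / R\<^sup>2 - \<alpha> * B)
       \<le> 24 / R\<^sup>2 + 96 * \<kappa> * p / R\<^sup>2"
      using i1 i2 i3 i4 by (simp add: distrib_left algebra_simps)
    also have "\<dots> = (24 + 96 * (\<kappa> * p)) / R\<^sup>2" by (simp add: add_divide_distrib)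
    finally have main: "- 64 * \<kappa>\<^sup>2 * p * B + 4 * p * (B2 / R\<^sup>2 / R\<^sup>2 + 2 * \<alpha> * B1 / R\<^sup>2 + \<alpha>\<^sup>2 * B) + 2 * CARD('n) * (- B1 / R\<^sup>2 - \<alpha> * B)
       \<le> (24 + 96 * (\<kappa> * p)) / R\<^sup>2" (is "?M \<le> _") .
    have ex: "(24 + 96 * (\<kappa> * p)) * e \<le> 120 * exp (- \<kappa> * p)"
    proof -
      have "0 \<le> \<kappa> * p" using assms(1) p by simp
      then have "24 + 96 * (\<kappa> * p) \<le> 120 * exp (\<kappa> * p)"
        using exp_ge_add_one_self[of "\<kappa> * p"] by linarith
      moreover have "e \<le> exp (- (2 * \<kappa>) * p)" unfolding e_def using \<alpha>1 p by (simp add: mult_right_mono)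
      ultimately have "(24 + 96 * (\<kappa> * p)) * e \<le> (120 * exp (\<kappa> * p)) * exp (- (2 * \<kappa>) * p)"
        by (intro mult_mono) (auto simp: e_def)
      also have "\<dots> = 120 * exp (- \<kappa> * p)" by (simp add: mult.assoc flip: exp_add)
      finally show ?thesis .
    qed
    have "?Gt ?p ?t + (4 * ?p * ?Gpp ?p ?t + 2 * CARD('n) * ?Gp ?p ?t) = - barrier_loss \<kappa> s r R p ?t + ?M * e * \<theta>"
      unfolding barrier_loss_def p_def[symmetric] \<alpha>_def[symmetric] e_def[symmetric] \<theta>_def[symmetric] B_def[symmetric] B1_def[symmetric] B2_def[symmetric]
      by (simp add: algebra_simps)
    also have "?M * e * \<theta> \<le> (24 + 96 * (\<kappa> * p)) / R\<^sup>2 * e * \<theta>"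
      using main B by (intro mult_right_mono) (auto simp: e_def)
    also have "\<dots> = ((24 + 96 * (\<kappa> * p)) * e) * (\<theta> / R\<^sup>2)" by simp
    also have "\<dots> \<le> (120 * exp (- \<kappa> * p)) * (\<theta> / R\<^sup>2)" using ex B by (intro mult_right_mono) auto
    also have "\<dots> = 120 / R\<^sup>2 * \<theta> * exp (- \<kappa> * p)" by simp
    finally show "?Gt ?p ?t + (4 * ?p * ?Gpp ?p ?t + 2 * CARD('n) * ?Gp ?p ?t)
        \<le> - barrier_loss \<kappa> s r R ?p ?t + 120 / R\<^sup>2 * ?\<theta> ?t * exp (- \<kappa> * ?p)"
      by (simp add: p_def \<theta>_def)
  qed
qed

text \<open>
  Testing Kato's inequality with the barrier bounds the integral of \<open>\<bar>U\<bar>\<close> against the loss term by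
  \<open>O(R\<^sup>-\<^sup>2)\<close>. The loss term is nonnegative where \<open>U\<close> may be nonzero and it increases with \<open>R\<close>, so its integral is
  zero for every radius; it is positive on \<open>\<bar>x\<bar> < R\<close>, \<open>0 < t < r\<close>.
\<close>

lemma uniqueness_step:
  fixes U :: "(real^'n) \<times> real \<Rightarrow> real"
  assumes U: "U \<in> borel_measurable borel" "\<And>R. integrable lborel (\<lambda>z. indicator (cball 0 R) z * U z)"
    and kato: "\<And>\<phi> a b R \<tau>. C21 \<phi> a b \<Longrightarrow> (\<And>z. \<phi> z \<ge> 0) \<Longrightarrow> \<tau> < T \<Longrightarrow>
        (\<And>z. norm z > R \<or> snd z > \<tau> \<Longrightarrow> \<phi> z = 0) \<Longrightarrow> (\<integral>z. \<bar>U z\<bar> * (a z + b z) \<partial>lborel) \<ge> 0"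
    and \<kappa>: "\<kappa> > 0" and growth: "integrable lborel (\<lambda>z. exp (- \<kappa> * (norm (fst z))\<^sup>2) * \<bar>U z\<bar>)"
    and before: "AE z in lborel. snd z < s \<longrightarrow> U z = 0" and s: "0 \<le> s" "s < r" "r \<le> s + 1 / (32 * \<kappa>)" "r < T"
  shows "AE z in lborel. s \<le> snd z \<and> snd z < r \<longrightarrow> U z = 0"
proof -
  note [measurable] = U(1)
  have r: "r > 0" using s by linarith
  let ?m = "\<lambda>R (z::(real^'n) \<times> real). barrier_loss \<kappa> s r R ((norm (fst z))\<^sup>2) (snd z)"
  define I where "I = (\<integral>z. exp (- \<kappa> * (norm (fst z))\<^sup>2) * \<bar>U z\<bar> \<partial>lborel)"
  have off: "(norm (fst z))\<^sup>2 > R\<^sup>2 \<or> (snd z)\<^sup>2 > r\<^sup>2" if "R > 0" "norm z > R + r" for R and z :: "(real^'n) \<times> real"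
  proof (rule ccontr)
    assume "\<not> ?thesis"
    then have "norm (fst z) \<le> R" "\<bar>snd z\<bar> \<le> r" using that r
      by (auto simp: not_less intro: power2_le_imp_le abs_le_square_iff[THEN iffD2, of "snd z" r, simplified])
    moreover have "norm z \<le> norm (fst z) + norm (snd z)" by (metis norm_Pair_le prod.collapse)
    ultimately show False using that by simp
  qed
  have off': "1 - (norm (fst z))\<^sup>2 / R\<^sup>2 \<le> 0 \<or> r\<^sup>2 - (snd z)\<^sup>2 \<le> 0"
    if "R > 0" "(norm (fst z))\<^sup>2 > R\<^sup>2 \<or> (snd z)\<^sup>2 > r\<^sup>2" for R and z :: "(real^'n) \<times> real"
  proof -
    have "1 \<le> (norm (fst z))\<^sup>2 / R\<^sup>2" if "(norm (fst z))\<^sup>2 > R\<^sup>2"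
      using less_imp_le[OF that] \<open>R > 0\<close> by (subst le_divide_eq_1_pos) simp_all
    with that(2) show ?thesis by fastforce
  qed
  have mint: "integrable lborel (\<lambda>z. \<bar>U z\<bar> * ?m R z)" if R: "R > 0" for R
  proof -
    have c: "continuous_on UNIV (?m R)" unfolding barrier_loss_def
      by (intro continuous_intros continuous_pos_cube) (use R in auto)
    have z: "?m R z = 0" if "z \<notin> cball 0 (R + r)" for z
      using off'[OF R off[OF R, of z]] that by (auto simp: barrier_loss_def pos_cube_simps)
    obtain B where B: "\<And>z. \<bar>?m R z\<bar> \<le> B" using compact_support_bounded[OF c compact_cball z] by blast
    have "integrable lborel (\<lambda>z. \<bar>indicator (cball 0 (R + r)) z * U z\<bar> * ?m R z)"
      by (rule integrable_mult_bounded[OF integrable_abs[OF U(2)] borel_measurable_continuous_onI[OF c] B])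
    moreover have "\<bar>indicator (cball 0 (R + r)) z * U z\<bar> * ?m R z = \<bar>U z\<bar> * ?m R z" for z
      using z[of z] by (cases "z \<in> cball 0 (R + r)") auto
    ultimately show ?thesis by simp
  qed
  have est: "(\<integral>z. \<bar>U z\<bar> * ?m R z \<partial>lborel) \<le> 120 * pos_cube (r\<^sup>2) * I / R\<^sup>2" if R: "R > 0" for R
  proof -
    obtain a b where C: "C21 (\<lambda>z::(real^'n) \<times> real. barrier \<kappa> s r R ((norm (fst z))\<^sup>2) (snd z)) a b"
      and up: "\<And>z. s \<le> snd z \<Longrightarrow> snd z \<le> s + 1 / (32 * \<kappa>) \<Longrightarrow>
      a z + b z \<le> - barrier_loss \<kappa> s r R ((norm (fst z))\<^sup>2) (snd z)
        + 120 / R\<^sup>2 * pos_cube (r\<^sup>2 - (snd z)\<^sup>2) * exp (- \<kappa> * (norm (fst z))\<^sup>2)"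
      and z0: "\<And>z. (snd z)\<^sup>2 \<ge> r\<^sup>2 \<Longrightarrow> a z + b z = 0"
      by (rule barrier_C21[OF \<kappa> R]) blast
    have sup: "barrier \<kappa> s r R ((norm (fst z))\<^sup>2) (snd z) = 0" if z: "norm z > R + r \<or> snd z > r" for z :: "(real^'n) \<times> real"
    proof -
      have "(norm (fst z))\<^sup>2 > R\<^sup>2 \<or> (snd z)\<^sup>2 > r\<^sup>2"
        using z off[OF R, of z] r power_strict_mono[of r "snd z" 2] by auto
      from off'[OF R this] show ?thesis by (auto simp: barrier_def pos_cube_simps)
    qed
    have "0 \<le> (\<integral>z. \<bar>U z\<bar> * (a z + b z) \<partial>lborel)"
      by (rule kato[OF C _ s(4) sup]) (simp add: barrier_def pos_cube_simps)
    also have "\<dots> \<le> (\<integral>z. - (\<bar>U z\<bar> * ?m R z) + 120 * pos_cube (r\<^sup>2) / R\<^sup>2 * (exp (- \<kappa> * (norm (fst z))\<^sup>2) * \<bar>U z\<bar>) \<partial>lborel)"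
    proof (rule integral_mono_AE)
      show "integrable lborel (\<lambda>z. \<bar>U z\<bar> * (a z + b z))"
      proof -
        have c: "continuous_on UNIV (\<lambda>z. a z + b z)" by (intro continuous_intros C21_continuous[OF C])
        have z: "a z + b z = 0" if "z \<notin> cball 0 (R + r)" for z
        proof -
          have "barrier \<kappa> s r R ((norm (fst z))\<^sup>2) (snd z) = 0" if "z \<notin> cball 0 (R + r)" for z :: "(real^'n) \<times> real"
            using that by (intro sup) auto
          from C21_eq_0_off_support[OF C closed_cball this that] show ?thesis by simp
        qed
        obtain B where B: "\<And>z. \<bar>a z + b z\<bar> \<le> B" using compact_support_bounded[OF c compact_cball z] by blast
        have "integrable lborel (\<lambda>z. \<bar>indicator (cball 0 (R + r)) z * U z\<bar> * (a z + b z))"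
          by (rule integrable_mult_bounded[OF integrable_abs[OF U(2)] borel_measurable_continuous_onI[OF c] B])
        moreover have "\<bar>indicator (cball 0 (R + r)) z * U z\<bar> * (a z + b z) = \<bar>U z\<bar> * (a z + b z)" for z
          using z[of z] by (cases "z \<in> cball 0 (R + r)") auto
        ultimately show ?thesis by simp
      qed
      show "integrable lborel (\<lambda>z. - (\<bar>U z\<bar> * ?m R z) + 120 * pos_cube (r\<^sup>2) / R\<^sup>2 * (exp (- \<kappa> * (norm (fst z))\<^sup>2) * \<bar>U z\<bar>))"
        by (intro Bochner_Integration.integrable_add integrable_minus mint[OF R] integrable_mult_right growth)
      show "AE z in lborel. \<bar>U z\<bar> * (a z + b z) \<le> - (\<bar>U z\<bar> * ?m R z) + 120 * pos_cube (r\<^sup>2) / R\<^sup>2 * (exp (- \<kappa> * (norm (fst z))\<^sup>2) * \<bar>U z\<bar>)"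
        using before
      proof (rule eventually_mono)
        fix z :: "(real^'n) \<times> real" assume b: "snd z < s \<longrightarrow> U z = 0"
        consider "snd z < s" | "s \<le> snd z" "snd z < r" | "r \<le> snd z" by linarith
        then show "\<bar>U z\<bar> * (a z + b z) \<le> - (\<bar>U z\<bar> * ?m R z) + 120 * pos_cube (r\<^sup>2) / R\<^sup>2 * (exp (- \<kappa> * (norm (fst z))\<^sup>2) * \<bar>U z\<bar>)"
        proof cases
          case 1 then show ?thesis using b by simp
        next
          case 2
          have "pos_cube (r\<^sup>2 - (snd z)\<^sup>2) \<le> pos_cube (r\<^sup>2)" unfolding pos_cube_def by (intro power_mono) auto
          then have "120 / R\<^sup>2 * pos_cube (r\<^sup>2 - (snd z)\<^sup>2) * exp (- \<kappa> * (norm (fst z))\<^sup>2) \<le> 120 / R\<^sup>2 * pos_cube (r\<^sup>2) * exp (- \<kappa> * (norm (fst z))\<^sup>2)"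
            by (intro mult_right_mono mult_left_mono) auto
          with up[of z] 2 s have "a z + b z \<le> - ?m R z + 120 / R\<^sup>2 * pos_cube (r\<^sup>2) * exp (- \<kappa> * (norm (fst z))\<^sup>2)" by linarith
          then have "\<bar>U z\<bar> * (a z + b z) \<le> \<bar>U z\<bar> * (- ?m R z + 120 / R\<^sup>2 * pos_cube (r\<^sup>2) * exp (- \<kappa> * (norm (fst z))\<^sup>2))"
            by (intro mult_left_mono) auto
          then show ?thesis by (simp add: algebra_simps)
        next
          case 3
          then have "(snd z)\<^sup>2 \<ge> r\<^sup>2" using r by (intro power_mono) auto
          then have "a z + b z = 0" "?m R z = 0" using z0 by (auto simp: barrier_loss_def pos_cube_simps)
          then show ?thesis using R by (simp add: pos_cube_simps)
        qed
      qed
    qed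
    also have "\<dots> = - (\<integral>z. \<bar>U z\<bar> * ?m R z \<partial>lborel) + 120 * pos_cube (r\<^sup>2) / R\<^sup>2 * I"
      unfolding I_def using mint[OF R] growth by (subst Bochner_Integration.integral_add) auto
    finally show ?thesis by simp
  qed
  have m_nonneg: "AE z in lborel. 0 \<le> \<bar>U z\<bar> * ?m R z" for R
    using before
  proof (rule eventually_mono)
    fix z :: "(real^'n) \<times> real" assume "snd z < s \<longrightarrow> U z = 0"
    then show "0 \<le> \<bar>U z\<bar> * ?m R z"
      using s(1) by (cases "snd z < s") (auto simp: barrier_loss_def pos_cube_simps)
  qed
  have zero: "AE z in lborel. \<bar>U z\<bar> * ?m R z = 0" if R: "R > 0" for R
  proof -
    have le: "(\<integral>z. \<bar>U z\<bar> * ?m R z \<partial>lborel) \<le> 120 * pos_cube (r\<^sup>2) * I / R'\<^sup>2" if R': "R' \<ge> R" for R'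
    proof -
      have "(\<integral>z. \<bar>U z\<bar> * ?m R z \<partial>lborel) \<le> (\<integral>z. \<bar>U z\<bar> * ?m R' z \<partial>lborel)"
      proof (rule integral_mono_AE)
        show "AE z in lborel. \<bar>U z\<bar> * ?m R z \<le> \<bar>U z\<bar> * ?m R' z"
          using before
        proof (rule eventually_mono)
          fix z :: "(real^'n) \<times> real" assume b: "snd z < s \<longrightarrow> U z = 0"
          show "\<bar>U z\<bar> * ?m R z \<le> \<bar>U z\<bar> * ?m R' z"
          proof (cases "snd z < s")
            case False
            have "(norm (fst z))\<^sup>2 / R'\<^sup>2 \<le> (norm (fst z))\<^sup>2 / R\<^sup>2"
              using R R' by (intro divide_left_mono power_mono) auto
            then have "pos_cube (1 - (norm (fst z))\<^sup>2 / R\<^sup>2) \<le> pos_cube (1 - (norm (fst z))\<^sup>2 / R'\<^sup>2)"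
              unfolding pos_cube_def by (intro power_mono) auto
            then have "?m R z \<le> ?m R' z" unfolding barrier_loss_def
              using False s(1) by (intro mult_right_mono) (auto simp: pos_cube_simps)
            then show ?thesis by (intro mult_left_mono) auto
          qed (use b in simp)
        qed
      qed (use mint R R' in auto)
      also have "\<dots> \<le> 120 * pos_cube (r\<^sup>2) * I / R'\<^sup>2" using R R' by (intro est) auto
      finally show ?thesis .
    qed
    have "((\<lambda>R'. 120 * pos_cube (r\<^sup>2) * I / R'\<^sup>2) \<longlongrightarrow> 0) at_top"
      by (intro tendsto_divide_0[OF tendsto_const] filterlim_at_top_imp_at_infinity filterlim_pow_at_top filterlim_ident) auto
    then have "(\<integral>z. \<bar>U z\<bar> * ?m R z \<partial>lborel) \<le> 0"
      by (rule tendsto_lowerbound[OF _ eventually_mono[OF eventually_ge_at_top[of R] le]]) auto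
    moreover have "(\<integral>z. \<bar>U z\<bar> * ?m R z \<partial>lborel) \<ge> 0" by (rule integral_nonneg_AE[OF m_nonneg])
    ultimately show ?thesis using integral_nonneg_eq_0_iff_AE[OF mint[OF R] m_nonneg] by simp
  qed
  have "AE z in lborel. \<forall>k::nat. \<bar>U z\<bar> * ?m (real (Suc k)) z = 0"
    by (subst AE_all_countable) (use zero in auto)
  moreover have "AE z in lborel. snd (z :: (real^'n) \<times> real) \<noteq> 0"
  proof -
    have "negligible {z :: (real^'n) \<times> real. (0, 1) \<bullet> z = 0}" by (rule negligible_hyperplane) (simp add: zero_prod_def)
    from AE_lborel_not_negligible[OF this] show ?thesis by (rule eventually_mono) (auto simp: inner_prod_def)
  qed
  ultimately show ?thesis
  proof eventually_elim
    case (elim z)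
    show "s \<le> snd z \<and> snd z < r \<longrightarrow> U z = 0"
    proof
      assume t: "s \<le> snd z \<and> snd z < r"
      then have tp: "snd z > 0" using s elim(2) by linarith
      obtain k :: nat where k: "norm (fst z) < real k" using reals_Archimedean2 by blast
      then have "(norm (fst z))\<^sup>2 < (real (Suc k))\<^sup>2" by (intro power_strict_mono) auto
      then have "1 - (norm (fst z))\<^sup>2 / (real (Suc k))\<^sup>2 > 0" by (simp add: field_simps)
      moreover have "(snd z)\<^sup>2 < r\<^sup>2" using t tp by (intro power_strict_mono) auto
      ultimately have "?m (real (Suc k)) z > 0" unfolding barrier_loss_def using tp
        by (intro mult_pos_pos pos_cube_simps) auto
      with elim(1) show "U z = 0" by (metis abs_eq_0 mult_eq_0_iff less_irrefl)
    qed
  qed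
qed

section \<open>Uniqueness\<close>

text \<open>
  The step length \<open>1 / (32 \<kappa>)\<close> does not depend on the starting time, so induction on the number of
  steps covers every time below \<open>T\<close>.
\<close>

lemma uniqueness_before:
  fixes U :: "(real^'n) \<times> real \<Rightarrow> real"
  assumes U: "U \<in> borel_measurable borel" "\<And>R. integrable lborel (\<lambda>z. indicator (cball 0 R) z * U z)"
    and kato: "\<And>\<phi> a b R \<tau>. C21 \<phi> a b \<Longrightarrow> (\<And>z. \<phi> z \<ge> 0) \<Longrightarrow> \<tau> < T \<Longrightarrow>
        (\<And>z. norm z > R \<or> snd z > \<tau> \<Longrightarrow> \<phi> z = 0) \<Longrightarrow> (\<integral>z. \<bar>U z\<bar> * (a z + b z) \<partial>lborel) \<ge> 0"
    and \<kappa>: "\<kappa> > 0" and growth: "integrable lborel (\<lambda>z. exp (- \<kappa> * (norm (fst z))\<^sup>2) * \<bar>U z\<bar>)"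
    and zero: "AE z in lborel. snd z \<le> 0 \<longrightarrow> U z = 0"
  shows "AE z in lborel. snd z < T \<longrightarrow> U z = 0"
proof -
  define \<delta> where "\<delta> = 1 / (32 * \<kappa>)"
  have \<delta>: "\<delta> > 0" using \<kappa> by (simp add: \<delta>_def)
  have steps: "AE z in lborel. snd z < r \<longrightarrow> U z = 0" if "r < T" "r \<le> real k * \<delta>" for r k
    using that
  proof (induction k arbitrary: r)
    case 0
    then show ?case using zero by (auto elim!: eventually_mono)
  next
    case (Suc k)
    show ?case
    proof (cases "r \<le> 0")
      case True
      then show ?thesis using zero by (auto elim!: eventually_mono)
    next
      case False
      define s where "s = max 0 (r - \<delta>)"
      have s: "0 \<le> s" "s < r" "r \<le> s + 1 / (32 * \<kappa>)" using False \<delta> by (auto simp: s_def \<delta>_def[symmetric])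
      have "s < T" "s \<le> real k * \<delta>" using s(2) Suc.prems \<delta> by (auto simp: s_def algebra_simps)
      then have b: "AE z in lborel. snd z < s \<longrightarrow> U z = 0" by (rule Suc.IH)
      have "AE z in lborel. s \<le> snd z \<and> snd z < r \<longrightarrow> U z = 0"
        by (rule uniqueness_step[OF U kato \<kappa> growth b s Suc.prems(1)])
      with b show ?thesis by eventually_elim auto
    qed
  qed
  have "AE z in lborel. snd z < T - 1 / real (Suc m) \<longrightarrow> U z = 0" for m
  proof -
    obtain k :: nat where "(T - 1 / real (Suc m)) / \<delta> \<le> real k" using real_arch_simple by blast
    then have "T - 1 / real (Suc m) \<le> real k * \<delta>" using \<delta> by (simp add: pos_divide_le_eq)
    then show ?thesis by (intro steps) auto
  qed
  then have "AE z in lborel. \<forall>m. snd z < T - 1 / real (Suc m) \<longrightarrow> U z = 0"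
    by (subst AE_all_countable) blast
  then show ?thesis
  proof (rule eventually_mono, intro impI)
    fix z :: "(real^'n) \<times> real"
    assume a: "\<forall>m. snd z < T - 1 / real (Suc m) \<longrightarrow> U z = 0" and "snd z < T"
    then obtain m where "inverse (real (Suc m)) < T - snd z" using reals_Archimedean[of "T - snd z"] by auto
    then have "snd z < T - 1 / real (Suc m)" by (simp add: inverse_eq_divide)
    with a show "U z = 0" by blast
  qed
qed

theorem theoremB:
  fixes T :: real and V u :: "(real^'n) \<times> real \<Rightarrow> real"
  assumes "T > 0"
    and "V \<in> Linf_loc (Q T)"
    and "AE z in lebesgue. z \<in> Q T \<longrightarrow> V z \<ge> 0"
    and "weak_solution T V (null_measure borel) u"
    and "\<exists>lam>0. (\<integral>\<^sup>+z\<in>Q T. ennreal ((1 + V z) * exp (- lam * (norm (fst z))\<^sup>2) * \<bar>u z\<bar>) \<partial>lebesgue) < \<infinity>"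
  shows "AE z in lebesgue. z \<in> Q T \<longrightarrow> u z = 0"
proof -
  have uL: "u \<in> L1_loc (Qbar T)" and VL: "(\<lambda>z. V z * u z) \<in> L1_loc (Qbar T)"
    and weak: "\<And>\<phi> g. \<phi> \<in> X T \<Longrightarrow> backward_heat T \<phi> g \<Longrightarrow>
        (LINT z:Q T|lebesgue. u z * g z) = (LINT z:Q T|lebesgue. V z * u z * \<phi> z)"
    using assms(4) unfolding weak_solution_def by auto
  have V: "AE z in lborel. z \<in> Q T \<longrightarrow> V z \<ge> 0" using assms(3) by (simp add: AE_completion_iff)
  obtain U where U: "U \<in> borel_measurable borel" "AE z in lborel. indicator (Q T) z * u z = U z"
    "\<And>R. integrable lborel (\<lambda>z. indicator (cball 0 R) z * U z)"
    "\<And>g. g \<in> borel_measurable borel \<Longrightarrow> (LINT z:Q T|lebesgue. u z * g z) = (\<integral>z. U z * g z \<partial>lborel)"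
    using L1_loc_borel_extension[OF uL] by blast
  obtain F where F: "F \<in> borel_measurable borel" "AE z in lborel. indicator (Q T) z * (V z * u z) = F z"
    "\<And>R. integrable lborel (\<lambda>z. indicator (cball 0 R) z * F z)"
    "\<And>g. g \<in> borel_measurable borel \<Longrightarrow> (LINT z:Q T|lebesgue. (V z * u z) * g z) = (\<integral>z. F z * g z \<partial>lborel)"
    using L1_loc_borel_extension[OF VL] by blast
  have eq: "(\<integral>z. U z * (a z + b z) \<partial>lborel) = (\<integral>z. F z * \<phi> z \<partial>lborel)"
    if \<phi>: "C21 \<phi> a b" "\<tau> < T" "\<And>z. norm z > R \<or> snd z > \<tau> \<Longrightarrow> \<phi> z = 0" for \<phi> a b R \<tau>
  proof -
    note c = C21_continuous[OF \<phi>(1)]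
    have "continuous_on UNIV (\<lambda>z. a z + b z)" by (intro continuous_intros c)
    then have "(\<lambda>z. a z + b z) \<in> borel_measurable borel" by (rule borel_measurable_continuous_onI)
    from U(4)[OF this] F(4)[OF borel_measurable_continuous_onI[OF c(1)]]
      weak[OF C21_in_X[OF \<phi>] C21_backward_heat[OF \<phi>(1)]]
    show ?thesis by simp
  qed
  \<comment> \<open>On \<open>Q T\<close> the product is \<open>V u\<^sup>2\<close>, so the absorption term has the sign that Kato's inequality needs.\<close>
  have sign: "AE z in lborel. U z * F z \<ge> 0"
    using U(2) F(2) V
  proof eventually_elim
    case (elim z)
    have "U z * F z = indicator (Q T) z * V z * (u z)\<^sup>2"
      unfolding elim(1,2)[symmetric] by (simp add: indicator_def power2_eq_square)
    then show ?case using elim(3) by (simp add: indicator_def)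
  qed
  obtain \<kappa> where \<kappa>: "\<kappa> > 0"
    and fin: "(\<integral>\<^sup>+z\<in>Q T. ennreal ((1 + V z) * exp (- \<kappa> * (norm (fst z))\<^sup>2) * \<bar>u z\<bar>) \<partial>lebesgue) < \<infinity>"
    using assms(5) by blast
  have growth: "integrable lborel (\<lambda>z. exp (- \<kappa> * (norm (fst z))\<^sup>2) * \<bar>U z\<bar>)"
  proof (rule integrableI_bounded)
    have "continuous_on UNIV (\<lambda>z :: (real^'n) \<times> real. exp (- \<kappa> * (norm (fst z))\<^sup>2))" by (intro continuous_intros)
    note [measurable] = borel_measurable_continuous_onI[OF this] U(1)
    show "(\<lambda>z. exp (- \<kappa> * (norm (fst z))\<^sup>2) * \<bar>U z\<bar>) \<in> borel_measurable lborel" by measurable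
    have "(\<integral>\<^sup>+z. ennreal (norm (exp (- \<kappa> * (norm (fst z))\<^sup>2) * \<bar>U z\<bar>)) \<partial>lborel)
       \<le> (\<integral>\<^sup>+z. ennreal ((1 + V z) * exp (- \<kappa> * (norm (fst z))\<^sup>2) * \<bar>u z\<bar>) * indicator (Q T) z \<partial>lborel)"
    proof (rule nn_integral_mono_AE, use U(2) V in eventually_elim)
      case (elim z)
      show ?case
      proof (cases "z \<in> Q T")
        case True
        then have "exp (- \<kappa> * (norm (fst z))\<^sup>2) * \<bar>u z\<bar> \<le> (1 + V z) * (exp (- \<kappa> * (norm (fst z))\<^sup>2) * \<bar>u z\<bar>)"
          using elim(2) by (simp add: distrib_right)
        with True show ?thesis using elim(1) by (auto simp: mult.assoc intro!: ennreal_leI)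
      next
        case False
        then show ?thesis using elim(1) by auto
      qed
    qed
    also have "\<dots> < \<infinity>" using fin by (simp add: nn_integral_completion)
    finally show "(\<integral>\<^sup>+z. ennreal (norm (exp (- \<kappa> * (norm (fst z))\<^sup>2) * \<bar>U z\<bar>)) \<partial>lborel) < \<infinity>" .
  qed
  have zero: "AE z in lborel. snd z \<le> 0 \<longrightarrow> U z = 0"
    using U(2) by (rule eventually_mono) (auto simp: Q_def indicator_def split: if_splits)
  have "AE z in lborel. snd z < T \<longrightarrow> U z = 0"
    by (rule uniqueness_before[OF U(1,3) kato_inequality[OF U(1,3) F(1,3) eq sign] \<kappa> growth zero])
  with U(2) have "AE z in lborel. z \<in> Q T \<longrightarrow> u z = 0"
    by eventually_elim (auto simp: Q_def indicator_def)
  then show ?thesis by (rule AE_completion)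
qed

end
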